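(* Let $X$ be a discrete metric space with bounded geometry. If $X$ has property A, then the $\ell^p$ uniform Roe algebra $B^p_u(X)$ is $p$-nuclear for every $p$ with $1<p<\infty$.
   Context: Scalars are complex. Bounded geometry: a metric space $(X,d)$ has bounded geometry if for every $R\ge 0$ there is $N_R\in\mathbb{N}$ such that every ball $B(x,R)$ of radius $R$ in $X$ has at most $N_R$ elements. $\ell^p$ uniform Roe algebra: for $T\in B(\ell^p(X))$ let $T_{xy}=\langle T\delta_y,\delta_x\rangle$ and $\mathrm{prop}(T)=\sup\{d(x,y):T_{xy}\ne 0\}\in[0,\infty]$. $\mathbb{C}^p_u[X]$ is the algebra of all $T\in B(\ell^p(X))$ with finite propagation, and $B^p_u(X)$ is its operator norm closure in $B(\ell^p(X))$. Property A: a discrete metric space $X$ with bounded geometry has property A if for every $p\in[1,\infty)$ and all $R,\varepsilon>0$ there is a map $\xi:X\to\ell^p(X)$, $x\mapsto\xi_x$, such that (1) $\|\xi_x\|_p=1$ for all $x\in X$; (2) there is $S>0$ such that $\xi_x$ is supported in $B(x,S)$ for every $x\in X$; (3) if $d(x,y)\le R$ then $\|\xi_x-\xi_y\|_p<\varepsilon$. (The validity of this condition does not depend on $p$.) $p$-nuclearity: an $L^p$-operator algebra is a norm-closed subalgebra $A$ of $B(L^p(\mu))$ for some measure $\mu$; it carries the matrix norms given by $M_n(A)\subseteq B(\ell^p_n\otimes_p L^p(\mu))=B(L^p(\mu)^{\oplus n})$, where $L^p(\mu)^{\oplus n}$ is the $\ell^p$-direct sum. $M_n^p$ denotes $M_n(\mathbb{C})=B(\ell^p_n)$,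 where $\ell^p_n$ is $\mathbb{C}^n$ with the $\ell^p$ norm. A linear map $\phi:V\to W$ between such spaces is a $p$-complete contraction if all amplifications $\phi_n:M_n(V)\to M_n(W)$, $[x_{ij}]\mapsto[\phi(x_{ij})]$, satisfy $\|\phi_n\|\le 1$. $A$ is $p$-nuclear if there are nets of $p$-complete contractions $\phi_\alpha:A\to M^p_{n(\alpha)}$ and $\psi_\alpha:M^p_{n(\alpha)}\to A$ with $\|\psi_\alpha\circ\phi_\alpha(a)-a\|\to 0$ for all $a\in A$. *)

theory Defs
  imports "HOL-Analysis.Analysis" "HOL-Library.Function_Algebras"
begin

section \<open>Spaces $L^p(\mu)$ and their bounded operators\<close>

text \<open>
  Elements of \<open>L\<^sup>p(M)\<close> are represented by functions that vanish outside \<open>space M\<close>. For a counting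
  measure \<open>count_space S\<close>, equality almost everywhere on \<open>S\<close> is equality, so
  \<open>Lp p (count_space S)\<close> is exactly \<open>\<ell>\<^sup>p(S)\<close>. For a general measure, almost everywhere equal
  functions have distance \<open>0\<close> in the seminorm \<open>Lp_norm\<close>.
\<close>

definition Lp :: "real \<Rightarrow> 'x measure \<Rightarrow> ('x \<Rightarrow> complex) set" where
  "Lp p M = {f \<in> borel_measurable M.
     integrable M (\<lambda>x. norm (f x) powr p) \<and> (\<forall>x. x \<notin> space M \<longrightarrow> f x = 0)}"

definition Lp_norm :: "real \<Rightarrow> 'x measure \<Rightarrow> ('x \<Rightarrow> complex) \<Rightarrow> real" where
  "Lp_norm p M f = (LINT x|M. norm (f x) powr p) powr (1 / p)"

type_synonym 'x opr = "('x \<Rightarrow> complex) \<Rightarrow> 'x \<Rightarrow> complex"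

text \<open>
  Sums, differences and zero of functions and operators are the pointwise ones of
  \<open>HOL-Library.Function_Algebras\<close>. Operators take the value \<open>0\<close> off \<open>L\<^sup>p(M)\<close>, so that they are
  determined by their restriction to \<open>L\<^sup>p(M)\<close>.
\<close>

definition bounded_oprs :: "real \<Rightarrow> 'x measure \<Rightarrow> 'x opr set" where
  "bounded_oprs p M = {T.
     (\<forall>f\<in>Lp p M. T f \<in> Lp p M) \<and>
     (\<forall>f\<in>Lp p M. \<forall>g\<in>Lp p M. T (f + g) = T f + T g) \<and>
     (\<forall>c. \<forall>f\<in>Lp p M. T (\<lambda>x. c * f x) = (\<lambda>x. c * T f x)) \<and>
     (\<exists>C. \<forall>f\<in>Lp p M. Lp_norm p M (T f) \<le> C * Lp_norm p M f) \<and>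
     (\<forall>f. f \<notin> Lp p M \<longrightarrow> T f = 0)}"

definition opr_norm :: "real \<Rightarrow> 'x measure \<Rightarrow> 'x opr \<Rightarrow> real" where
  "opr_norm p M T = Sup {Lp_norm p M (T f) | f. f \<in> Lp p M \<and> Lp_norm p M f \<le> 1}"


section \<open>Matrix norms and $p$-nuclearity\<close>

text \<open>
  The norm of \<open>[a i j]\<close> (\<open>i, j < k\<close>) as an operator on the \<open>\<ell>\<^sup>p\<close>-direct sum of \<open>k\<close> copies of
  \<open>L\<^sup>p(M)\<close>, whose elements are the tuples \<open>f 0, \<dots>, f (k - 1)\<close>.
\<close>

definition sum_norm :: "real \<Rightarrow> 'x measure \<Rightarrow> nat \<Rightarrow> (nat \<Rightarrow> 'x \<Rightarrow> complex) \<Rightarrow> real" where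
  "sum_norm p M k f = (\<Sum>i<k. Lp_norm p M (f i) powr p) powr (1 / p)"

definition matrix_norm :: "real \<Rightarrow> 'x measure \<Rightarrow> nat \<Rightarrow> (nat \<Rightarrow> nat \<Rightarrow> 'x opr) \<Rightarrow> real" where
  "matrix_norm p M k a = Sup {sum_norm p M k (\<lambda>i. \<Sum>j<k. a i j (f j)) | f.
     (\<forall>j<k. f j \<in> Lp p M) \<and> sum_norm p M k f \<le> 1}"

definition p_complete_contraction ::
  "real \<Rightarrow> 'x measure \<Rightarrow> 'x opr set \<Rightarrow> 'y measure \<Rightarrow> 'y opr set \<Rightarrow> ('x opr \<Rightarrow> 'y opr) \<Rightarrow> bool" where
  "p_complete_contraction p M V N W \<phi> \<longleftrightarrow>
     (\<forall>a\<in>V. \<phi> a \<in> W) \<and>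
     (\<forall>a\<in>V. \<forall>b\<in>V. \<phi> (a + b) = \<phi> a + \<phi> b) \<and>
     (\<forall>c. \<forall>a\<in>V. \<phi> (\<lambda>f x. c * a f x) = (\<lambda>f x. c * \<phi> a f x)) \<and>
     (\<forall>k a. (\<forall>i<k. \<forall>j<k. a i j \<in> V) \<longrightarrow>
        matrix_norm p N k (\<lambda>i j. \<phi> (a i j)) \<le> matrix_norm p M k a)"

text \<open>
  \<open>M\<^sup>p\<^sub>n = B(\<ell>\<^sup>p\<^sub>n)\<close>, acting on functions supported in \<open>{0, \<dots>, n - 1}\<close>.
\<close>

abbreviation fin_measure :: "nat \<Rightarrow> nat measure" where
  "fin_measure n \<equiv> count_space {..<n}"

abbreviation Mnp :: "real \<Rightarrow> nat \<Rightarrow> nat opr set" where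
  "Mnp p n \<equiv> bounded_oprs p (fin_measure n)"

definition directed :: "'i set \<Rightarrow> ('i \<Rightarrow> 'i \<Rightarrow> bool) \<Rightarrow> bool" where
  "directed I le \<longleftrightarrow> I \<noteq> {} \<and> (\<forall>\<alpha>\<in>I. le \<alpha> \<alpha>) \<and>
     (\<forall>\<alpha>\<in>I. \<forall>\<beta>\<in>I. \<forall>\<gamma>\<in>I. le \<alpha> \<beta> \<longrightarrow> le \<beta> \<gamma> \<longrightarrow> le \<alpha> \<gamma>) \<and>
     (\<forall>\<alpha>\<in>I. \<forall>\<beta>\<in>I. \<exists>\<gamma>\<in>I. le \<alpha> \<gamma> \<and> le \<beta> \<gamma>)"

definition approximating_net ::
  "real \<Rightarrow> 'x measure \<Rightarrow> 'x opr set \<Rightarrow> 'i set \<Rightarrow> ('i \<Rightarrow> 'i \<Rightarrow> bool) \<Rightarrow>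
   ('i \<Rightarrow> nat) \<Rightarrow> ('i \<Rightarrow> 'x opr \<Rightarrow> nat opr) \<Rightarrow> ('i \<Rightarrow> nat opr \<Rightarrow> 'x opr) \<Rightarrow> bool" where
  "approximating_net p M A I le n \<phi> \<psi> \<longleftrightarrow>
     directed I le \<and>
     (\<forall>\<alpha>\<in>I. n \<alpha> \<ge> 1 \<and>
        p_complete_contraction p M A (fin_measure (n \<alpha>)) (Mnp p (n \<alpha>)) (\<phi> \<alpha>) \<and>
        p_complete_contraction p (fin_measure (n \<alpha>)) (Mnp p (n \<alpha>)) M A (\<psi> \<alpha>)) \<and>
     (\<forall>a\<in>A. \<forall>e>0. \<exists>\<alpha>\<^sub>0\<in>I. \<forall>\<alpha>\<in>I. le \<alpha>\<^sub>0 \<alpha> \<longrightarrow> opr_norm p M (\<psi> \<alpha> (\<phi> \<alpha> a) - a) < e)"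

text \<open>
  HOL cannot quantify existentially over the type of net indices. Fixing it to be
  \<open>'x opr set \<times> nat\<close> loses nothing: from an approximating net over any index type one obtains
  another one indexed by the pairs \<open>(F, m)\<close> with \<open>F \<subseteq> A\<close> finite, by choosing for \<open>(F, m)\<close> an
  index at which all \<open>a \<in> F\<close> are approximated up to \<open>1 / (m + 1)\<close>.
\<close>

definition p_nuclear :: "real \<Rightarrow> 'x measure \<Rightarrow> 'x opr set \<Rightarrow> bool" where
  "p_nuclear p M A \<longleftrightarrow>
     (\<exists>(I :: ('x opr set \<times> nat) set) le n \<phi> \<psi>. approximating_net p M A I le n \<phi> \<psi>)"


section \<open>Metric spaces and uniform Roe algebras\<close>

definition bounded_geometry :: "'a::metric_space set \<Rightarrow> bool" where
  "bounded_geometry X \<longleftrightarrow>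
     (\<forall>R\<ge>0. \<exists>N. \<forall>x\<in>X. finite (cball x R \<inter> X) \<and> card (cball x R \<inter> X) \<le> N)"

abbreviation lp :: "real \<Rightarrow> 'a set \<Rightarrow> ('a \<Rightarrow> complex) set" where
  "lp p X \<equiv> Lp p (count_space X)"

abbreviation lp_norm :: "real \<Rightarrow> 'a set \<Rightarrow> ('a \<Rightarrow> complex) \<Rightarrow> real" where
  "lp_norm p X \<equiv> Lp_norm p (count_space X)"

definition property_A :: "'a::metric_space set \<Rightarrow> bool" where
  "property_A X \<longleftrightarrow>
     (\<forall>p\<ge>1. \<forall>R>0. \<forall>\<epsilon>>0. \<exists>\<xi> :: 'a \<Rightarrow> 'a \<Rightarrow> complex.
        (\<forall>x\<in>X. \<xi> x \<in> lp p X \<and> lp_norm p X (\<xi> x) = 1) \<and>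
        (\<exists>S>0. \<forall>x\<in>X. \<forall>y\<in>X. \<xi> x y \<noteq> 0 \<longrightarrow> y \<in> cball x S) \<and>
        (\<forall>x\<in>X. \<forall>y\<in>X. dist x y \<le> R \<longrightarrow> lp_norm p X (\<xi> x - \<xi> y) < \<epsilon>))"

definition entry :: "'a opr \<Rightarrow> 'a \<Rightarrow> 'a \<Rightarrow> complex" where
  "entry T x y = T (indicator {y}) x"

definition propagation :: "'a::metric_space set \<Rightarrow> 'a opr \<Rightarrow> ennreal" where
  "propagation X T = Sup {ennreal (dist x y) | x y. x \<in> X \<and> y \<in> X \<and> entry T x y \<noteq> 0}"

definition finite_prop_oprs :: "real \<Rightarrow> 'a::metric_space set \<Rightarrow> 'a opr set" where
  "finite_prop_oprs p X = {T \<in> bounded_oprs p (count_space X). propagation X T < \<infinity>}"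

definition uniform_Roe_algebra :: "real \<Rightarrow> 'a::metric_space set \<Rightarrow> 'a opr set" where
  "uniform_Roe_algebra p X = {T \<in> bounded_oprs p (count_space X).
     \<forall>e>0. \<exists>S\<in>finite_prop_oprs p X. opr_norm p (count_space X) (T - S) < e}"

end

theory Submission
  imports Defs
begin

text \<open>
  Property A supplies unit vectors \<open>w\<^sub>y \<ge> 0\<close> of \<open>\<ell>\<^sup>p(X)\<close>, supported in balls of radius \<open>S\<close> and almost constant
  at scale \<open>R\<close>. The map \<open>f \<mapsto> (w\<^sub>z(x) f(z))\<^sub>x\<^sub>,\<^sub>z\<close> embeds \<open>\<ell>\<^sup>p(X)\<close> isometrically into the \<open>\<ell>\<^sup>p\<close>-sum of
  the spaces \<open>\<ell>\<^sup>p(B(x, S))\<close>, and weighting by \<open>w\<^sub>y(x)\<^bsup>p - 1\<^esup>\<close> is a contraction back, by Hoelder's inequality.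
  Compressing \<open>a\<close> to the balls and reassembling therefore is a \<open>p\<close>-completely contractive Schur
  multiplication \<open>a\<^sub>y\<^sub>z \<mapsto> k(y, z) a\<^sub>y\<^sub>z\<close> with \<open>k(y, z) = \<Sum>\<^sub>x w\<^sub>y(x)\<^bsup>p - 1\<^esup> w\<^sub>z(x)\<close>, and \<open>k\<close> is close to \<open>1\<close> within
  the propagation of \<open>a\<close>. There are infinitely many balls, but by bounded geometry the compressions of
  finitely many operators of finite propagation form, after enumerating each ball, a bounded set of
  matrices of bounded size. Up to a small error finitely many blocks hence represent all of them, and
  these blocks sit block-diagonally in one matrix algebra \<open>M\<^sup>p\<^sub>n\<close>.
\<close>

section \<open>Spaces $\ell^p$ and bounds for operator matrices\<close>

text \<open>The \<open>p\<close>-th power of the norm is additive over disjoint sets of coordinates;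
  estimates are made for it, and roots are taken only on returning to actual norms.\<close>

definition lpow :: "real \<Rightarrow> 'a set \<Rightarrow> ('a \<Rightarrow> complex) \<Rightarrow> real" where
  "lpow p X f = (LINT x|count_space X. norm (f x) powr p)"

lemma lpow_nonneg: "lpow p X f \<ge> 0"
  unfolding lpow_def by (rule Bochner_Integration.integral_nonneg) simp

lemma lp_norm_nonneg: "lp_norm p X f \<ge> 0"
  by (simp add: Lp_norm_def)

lemma lp_iff_summable:
  "f \<in> lp p X \<longleftrightarrow> (\<lambda>x. norm (f x) powr p) summable_on X \<and> (\<forall>x. x \<notin> X \<longrightarrow> f x = 0)"
proof -
  have "integrable (count_space X) (\<lambda>x. norm (f x) powr p) \<longleftrightarrow> (\<lambda>x. norm (f x) powr p) summable_on X"
    using abs_summable_equivalent[of "\<lambda>x. norm (f x) powr p" X]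
    by (simp add: Infinite_Set_Sum.abs_summable_on_def)
  then show ?thesis
    by (simp add: Lp_def)
qed

lemma lp_support: "f \<in> lp p X \<Longrightarrow> x \<notin> X \<Longrightarrow> f x = 0"
  by (simp add: lp_iff_summable)

lemma lpow_eq_infsum:
  assumes "f \<in> lp p X"
  shows "lpow p X f = infsum (\<lambda>x. norm (f x) powr p) X"
proof -
  have "Infinite_Set_Sum.abs_summable_on (\<lambda>x. norm (f x) powr p) X"
    using assms abs_summable_equivalent[of "\<lambda>x. norm (f x) powr p" X]
    by (simp add: lp_iff_summable)
  from infsetsum_infsum[OF this] show ?thesis
    by (simp add: lpow_def infsetsum_def)
qed

lemma lpI:
  assumes "\<And>x. x \<notin> X \<Longrightarrow> f x = 0"
    and "\<And>Y. finite Y \<Longrightarrow> Y \<subseteq> X \<Longrightarrow> (\<Sum>x\<in>Y. norm (f x) powr p) \<le> K"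
  shows "f \<in> lp p X"
  unfolding lp_iff_summable
  using assms by (auto intro!: nonneg_bdd_above_summable_on bdd_aboveI[where M = K])

lemma sum_le_lpow:
  assumes "f \<in> lp p X" "finite Y" "Y \<subseteq> X"
  shows "(\<Sum>x\<in>Y. norm (f x) powr p) \<le> lpow p X f"
  using assms by (auto simp: lpow_eq_infsum lp_iff_summable intro!: finite_sum_le_infsum)

lemma lpow_le:
  assumes "f \<in> lp p X" "\<And>Y. finite Y \<Longrightarrow> Y \<subseteq> X \<Longrightarrow> (\<Sum>x\<in>Y. norm (f x) powr p) \<le> K"
  shows "lpow p X f \<le> K"
  using assms by (auto simp: lpow_eq_infsum lp_iff_summable intro!: infsum_le_finite_sums)

lemma lp_finite_support:
  assumes "finite Y" "Y \<subseteq> X" "\<And>x. x \<notin> Y \<Longrightarrow> f x = 0"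
  shows "f \<in> lp p X" "lpow p X f = (\<Sum>x\<in>Y. norm (f x) powr p)"
proof -
  have s: "(\<Sum>x\<in>Z. norm (f x) powr p) \<le> (\<Sum>x\<in>Y. norm (f x) powr p)" if "finite Z" for Z
  proof -
    have "(\<Sum>x\<in>Z. norm (f x) powr p) = (\<Sum>x\<in>Z \<inter> Y. norm (f x) powr p)"
      using assms that by (intro sum.mono_neutral_right) auto
    also have "\<dots> \<le> (\<Sum>x\<in>Y. norm (f x) powr p)"
      using assms by (intro sum_mono2) auto
    finally show ?thesis .
  qed
  show 1: "f \<in> lp p X"
    using assms s by (intro lpI) auto
  show "lpow p X f = (\<Sum>x\<in>Y. norm (f x) powr p)"
    using assms s by (intro antisym lpow_le[OF 1] sum_le_lpow[OF 1]) auto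
qed

text \<open>Once a finite set exhausts \<open>lpow\<close> up to \<open>e\<close>, any set disjoint
  from it adds at most \<open>e\<close>. This supplies the density of finitely supported
  functions.\<close>

lemma lp_tail:
  assumes "f \<in> lp p X" "e > 0"
  obtains Y where "finite Y" "Y \<subseteq> X"
    "\<And>Z. finite Z \<Longrightarrow> Z \<subseteq> X - Y \<Longrightarrow> (\<Sum>x\<in>Z. norm (f x) powr p) \<le> e"
proof -
  have "\<not> (\<forall>Y. finite Y \<longrightarrow> Y \<subseteq> X \<longrightarrow> (\<Sum>x\<in>Y. norm (f x) powr p) \<le> lpow p X f - e)"
    using lpow_le[OF assms(1), of "lpow p X f - e"] assms(2) by force
  then obtain Y where Y: "finite Y" "Y \<subseteq> X" "(\<Sum>x\<in>Y. norm (f x) powr p) > lpow p X f - e"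
    by (auto simp: not_le)
  have "(\<Sum>x\<in>Z. norm (f x) powr p) \<le> e" if Z: "finite Z" "Z \<subseteq> X - Y" for Z
  proof -
    have "(\<Sum>x\<in>Z. norm (f x) powr p) + (\<Sum>x\<in>Y. norm (f x) powr p) = (\<Sum>x\<in>Z \<union> Y. norm (f x) powr p)"
      using Y Z by (intro sum.union_disjoint[symmetric]) auto
    also have "\<dots> \<le> lpow p X f"
      using Y Z by (intro sum_le_lpow[OF assms(1)]) auto
    finally show ?thesis using Y by simp
  qed
  with that Y show ?thesis by blast
qed

section \<open>Inequalities for \<open>p\<close>-th powers and the vector space structure of
  l^p\<close>

locale exponent =
  fixes p :: real
  assumes p_gt_1: "1 < p"
begin

lemma lp_norm_powr: "lp_norm p X f powr p = lpow p X f"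
  using lpow_nonneg[of p X f] p_gt_1 by (simp add: Lp_norm_def lpow_def powr_powr)

lemma lp_norm_eq: "lp_norm p X f = lpow p X f powr (1 / p)"
  by (simp add: Lp_norm_def lpow_def)

lemma powr_root_mono: "0 \<le> s \<Longrightarrow> s \<le> K powr p * t \<Longrightarrow> 0 \<le> K \<Longrightarrow> 0 \<le> t \<Longrightarrow>
  s powr (1 / p) \<le> K * t powr (1 / p)"
  using powr_mono2[of "1 / p" s "K powr p * t"] p_gt_1 by (simp add: powr_mult powr_powr)

text \<open>Every summand is at most the largest one, whose \<open>p\<close>-th power occurs on the
  right. Convexity would give the exponent \<open>p - 1\<close> on the cardinality; the cruder
  factor suffices where only some bound matters or another factor can be made small.\<close>

lemma powr_sum_le:
  fixes u :: "'b \<Rightarrow> complex"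
  assumes "finite S"
  shows "norm (\<Sum>j\<in>S. u j) powr p \<le> real (card S) powr p * (\<Sum>j\<in>S. norm (u j) powr p)"
proof (cases "S = {}")
  case False
  define m where "m = Max ((\<lambda>j. norm (u j)) ` S)"
  have "m \<in> (\<lambda>j. norm (u j)) ` S"
    unfolding m_def using assms False by (intro Max_in) auto
  then obtain i where i: "i \<in> S" "m = norm (u i)" by auto
  have le: "norm (u j) \<le> m" if "j \<in> S" for j
    unfolding m_def using assms that by (intro Max_ge) auto
  have "norm (\<Sum>j\<in>S. u j) \<le> real (card S) * m"
    using sum_norm_le[of S u "\<lambda>_. m"] le by (simp add: mult.commute)
  then have "norm (\<Sum>j\<in>S. u j) powr p \<le> (real (card S) * m) powr p"
    using p_gt_1 by (intro powr_mono2) auto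
  also have "\<dots> = real (card S) powr p * norm (u i) powr p"
    using i by (simp add: powr_mult)
  also have "\<dots> \<le> real (card S) powr p * (\<Sum>j\<in>S. norm (u j) powr p)"
    using assms i by (intro mult_left_mono member_le_sum) auto
  finally show ?thesis .
qed simp

lemma powr_add_le:
  fixes u v :: complex
  shows "norm (u + v) powr p \<le> 2 powr p * (norm u powr p + norm v powr p)"
  using powr_sum_le[of "UNIV::bool set" "\<lambda>b. if b then u else v"] by (simp add: UNIV_bool add.commute)

text \<open>For the conjugate exponent \<open>q\<close> one has \<open>(p - 1) * q = p\<close>, so
  the weights \<open>w x powr (p - 1)\<close> have \<open>q\<close>-norm at most 1 and pairing with
  them is a contraction.\<close>

lemma Hoelder_weight:
  fixes u :: "'b \<Rightarrow> complex" and w :: "'b \<Rightarrow> real"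
  assumes "finite S" "\<And>x. x \<in> S \<Longrightarrow> w x \<ge> 0" "(\<Sum>x\<in>S. w x powr p) \<le> 1"
  shows "norm (\<Sum>x\<in>S. of_real (w x powr (p - 1)) * u x) powr p \<le> (\<Sum>x\<in>S. norm (u x) powr p)"
proof -
  define q where "q = p / (p - 1)"
  have q: "q > 1" "1 / p + 1 / q = 1" "(p - 1) * q = p"
    using p_gt_1 by (auto simp: q_def field_simps)
  define t where "t = (\<Sum>x\<in>S. norm (u x) powr p)"
  define s where "s = t powr (1 / p)"
  have t0: "t \<ge> 0" unfolding t_def by (intro sum_nonneg) auto
  \<comment> \<open>The normalization below divides by the norm \<open>s\<close> of
    \<open>u\<close>, so the zero vector is treated apart.\<close>
  show ?thesis
  proof (cases "t = 0")
    case True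
    then have "u x = 0" if "x \<in> S" for x
      using that assms(1) p_gt_1 by (simp add: t_def sum_nonneg_eq_0_iff)
    then have "(\<Sum>x\<in>S. of_real (w x powr (p - 1)) * u x) = 0"
      by (intro sum.neutral) auto
    with True show ?thesis using p_gt_1 by (simp add: t_def)
  next
    case False
    then have s: "s > 0" "s powr p = t" using t0 p_gt_1 by (auto simp: s_def powr_powr)
    have "norm (\<Sum>x\<in>S. of_real (w x powr (p - 1)) * u x) \<le> (\<Sum>x\<in>S. w x powr (p - 1) * norm (u x))"
      by (rule sum_norm_le) (simp add: norm_mult)
    also have "\<dots> = s * (\<Sum>x\<in>S. norm (u x) / s * w x powr (p - 1))"
      using s by (simp add: sum_distrib_left)  (simp add: mult.commute)
    \<comment> \<open>Young's inequality is applied termwise after \<open>u\<close> has been scaled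
      to norm 1; the two resulting sums are then at most \<open>1 / p\<close> and
      \<open>1 / q\<close>.\<close>
    also have "\<dots> \<le> s * (\<Sum>x\<in>S. (norm (u x) / s) powr p / p + (w x powr (p - 1)) powr q / q)"
      using s q p_gt_1 by (intro mult_left_mono sum_mono Youngs_inequality) auto
    also have "(\<Sum>x\<in>S. (norm (u x) / s) powr p / p + (w x powr (p - 1)) powr q / q)
      = (\<Sum>x\<in>S. norm (u x) powr p) / t / p + (\<Sum>x\<in>S. w x powr p) / q"
      using s assms(2) by (simp add: sum.distrib powr_powr q(3) powr_divide sum_divide_distrib)
    also have "\<dots> \<le> 1 / p + 1 / q"
      using assms(3) q(1) s t0 False by (intro add_mono divide_right_mono) (use p_gt_1 in \<open>auto simp: t_def\<close>)
    finally have "norm (\<Sum>x\<in>S. of_real (w x powr (p - 1)) * u x) \<le> s"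
      using q s by simp
    then have "norm (\<Sum>x\<in>S. of_real (w x powr (p - 1)) * u x) powr p \<le> s powr p"
      using p_gt_1 by (intro powr_mono2) auto
    with s show ?thesis by (simp add: t_def)
  qed
qed

lemma lp_add:
  assumes "f \<in> lp p X" "g \<in> lp p X"
  shows "f + g \<in> lp p X"
proof (rule lpI)
  fix Y assume Y: "finite Y" "Y \<subseteq> X"
  have "(\<Sum>x\<in>Y. norm ((f + g) x) powr p) \<le> (\<Sum>x\<in>Y. 2 powr p * (norm (f x) powr p + norm (g x) powr p))"
    using powr_add_le by (intro sum_mono) simp
  also have "\<dots> = 2 powr p * ((\<Sum>x\<in>Y. norm (f x) powr p) + (\<Sum>x\<in>Y. norm (g x) powr p))"
    by (simp add: distrib_left sum.distrib flip: sum_distrib_left)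
  also have "\<dots> \<le> 2 powr p * (lpow p X f + lpow p X g)"
    using assms Y by (intro mult_left_mono add_mono sum_le_lpow) auto
  finally show "(\<Sum>x\<in>Y. norm ((f + g) x) powr p) \<le> 2 powr p * (lpow p X f + lpow p X g)" .
qed (use assms in \<open>auto simp: lp_support\<close>)

lemma lp_scale:
  assumes "f \<in> lp p X"
  shows "(\<lambda>x. c * f x) \<in> lp p X" "lpow p X (\<lambda>x. c * f x) = norm c powr p * lpow p X f"
proof -
  show "lpow p X (\<lambda>x. c * f x) = norm c powr p * lpow p X f"
    by (simp add: lpow_def norm_mult powr_mult)
  show "(\<lambda>x. c * f x) \<in> lp p X"
  proof (rule lpI)
    fix Y assume Y: "finite Y" "Y \<subseteq> X"
    have "(\<Sum>x\<in>Y. norm (c * f x) powr p) = norm c powr p * (\<Sum>x\<in>Y. norm (f x) powr p)"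
      by (simp add: norm_mult powr_mult sum_distrib_left)
    also have "\<dots> \<le> norm c powr p * lpow p X f"
      using assms Y by (intro mult_left_mono sum_le_lpow) auto
    finally show "(\<Sum>x\<in>Y. norm (c * f x) powr p) \<le> norm c powr p * lpow p X f" .
  qed (use assms in \<open>auto simp: lp_support\<close>)
qed

lemma lp_zero: "0 \<in> lp p X"
  by (rule lpI[where K = 0]) auto

lemma lp_sum:
  assumes "finite S" "\<And>j. j \<in> S \<Longrightarrow> f j \<in> lp p X"
  shows "(\<Sum>j\<in>S. f j) \<in> lp p X"
  using assms by (induction S rule: finite_induct) (auto intro: lp_zero lp_add)

end

lemma sum_fun_apply: "(\<Sum>j\<in>S. f j) x = (\<Sum>j\<in>S. f j x)"
  by (induction S rule: infinite_finite_induct) auto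

text \<open>Serves to exchange a tuple of length one for its only entry when \<open>opr_norm\<close>
  is identified with a 1 x 1 matrix norm.\<close>

lemma ex_comp_surj: "surj g \<Longrightarrow> (\<exists>x. P (g x)) \<longleftrightarrow> (\<exists>y. P y)"
  by (metis surjD)

lemma has_sum_sum:
  fixes f :: "'i \<Rightarrow> 'x \<Rightarrow> real"
  assumes "finite I" "\<And>i. i \<in> I \<Longrightarrow> f i summable_on A"
  shows "((\<lambda>x. \<Sum>i\<in>I. f i x) has_sum (\<Sum>i\<in>I. infsum (f i) A)) A"
  using assms by (induction I rule: finite_induct) (auto intro: has_sum_add)

text \<open>Norm bounds are tested on finite sets of coordinates, so that all rearrangements of sums below
  are finite.\<close>
definition mat_bound ::
  "real \<Rightarrow> 'a set \<Rightarrow> nat \<Rightarrow> (nat \<Rightarrow> nat \<Rightarrow> 'a opr) \<Rightarrow> real \<Rightarrow> bool" where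
  "mat_bound p X k a K \<longleftrightarrow> (\<forall>f Y. (\<forall>j<k. f j \<in> lp p X) \<longrightarrow> finite Y \<longrightarrow> Y \<subseteq> X \<longrightarrow>
     (\<Sum>i<k. \<Sum>y\<in>Y. norm (\<Sum>j<k. a i j (f j) y) powr p) \<le> K powr p * (\<Sum>j<k. lpow p X (f j)))"

definition op_bound :: "real \<Rightarrow> 'a set \<Rightarrow> 'a opr \<Rightarrow> real \<Rightarrow> bool" where
  "op_bound p X T K \<longleftrightarrow> (\<forall>f Y. f \<in> lp p X \<longrightarrow> finite Y \<longrightarrow> Y \<subseteq> X \<longrightarrow>
     (\<Sum>y\<in>Y. norm (T f y) powr p) \<le> K powr p * lpow p X f)"

lemma mat_boundD:
  "mat_bound p X k a K \<Longrightarrow> (\<And>j. j < k \<Longrightarrow> f j \<in> lp p X) \<Longrightarrow> finite Y \<Longrightarrow> Y \<subseteq> X \<Longrightarrow>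
     (\<Sum>i<k. \<Sum>y\<in>Y. norm (\<Sum>j<k. a i j (f j) y) powr p) \<le> K powr p * (\<Sum>j<k. lpow p X (f j))"
  by (simp add: mat_bound_def)

lemma op_boundD:
  "op_bound p X T K \<Longrightarrow> f \<in> lp p X \<Longrightarrow> finite Y \<Longrightarrow> Y \<subseteq> X \<Longrightarrow>
     (\<Sum>y\<in>Y. norm (T f y) powr p) \<le> K powr p * lpow p X f"
  by (simp add: op_bound_def)

lemma op_bound_iff_mat_bound: "op_bound p X T K \<longleftrightarrow> mat_bound p X 1 (\<lambda>_ _. T) K"
proof
  assume "mat_bound p X 1 (\<lambda>_ _. T) K"
  then show "op_bound p X T K"
    unfolding op_bound_def by (auto dest: mat_boundD[where f = "\<lambda>_. f" for f])
qed (simp add: op_bound_def mat_bound_def)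

section \<open>Bounded operators on l^p\<close>

lemma bounded_opr_lp: "T \<in> bounded_oprs p (count_space X) \<Longrightarrow> T f \<in> lp p X"
  by (cases "f \<in> lp p X") (auto simp: bounded_oprs_def intro: lpI[where K = 0])

lemma bounded_opr_add:
  "T \<in> bounded_oprs p M \<Longrightarrow> f \<in> Lp p M \<Longrightarrow> g \<in> Lp p M \<Longrightarrow> T (f + g) = T f + T g"
  by (simp add: bounded_oprs_def)

lemma bounded_opr_scale:
  "T \<in> bounded_oprs p M \<Longrightarrow> f \<in> Lp p M \<Longrightarrow> T (\<lambda>x. c * f x) = (\<lambda>x. c * T f x)"
  by (simp add: bounded_oprs_def)

lemma bounded_opr_outside: "T \<in> bounded_oprs p M \<Longrightarrow> f \<notin> Lp p M \<Longrightarrow> T f = 0"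
  by (simp add: bounded_oprs_def)

context exponent
begin

lemma bounded_opr_op_bound:
  assumes "T \<in> bounded_oprs p (count_space X)"
  obtains K where "K \<ge> 0" "op_bound p X T K"
proof -
  from assms obtain C where C: "\<And>f. f \<in> lp p X \<Longrightarrow> lp_norm p X (T f) \<le> C * lp_norm p X f"
    unfolding bounded_oprs_def by blast
  \<comment> \<open>The constant \<open>C\<close> carries no sign, while monotonicity of
    \<open>powr\<close> needs a nonnegative one.\<close>
  define K where "K = max C 0"
  have "(\<Sum>y\<in>Y. norm (T f y) powr p) \<le> K powr p * lpow p X f"
    if f: "f \<in> lp p X" and Y: "finite Y" "Y \<subseteq> X" for f Y
  proof -
    have "lp_norm p X (T f) \<le> K * lp_norm p X f"
      using C[OF f] by (rule order_trans) (simp add: K_def mult_right_mono lp_norm_nonneg)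
    then have "lp_norm p X (T f) powr p \<le> (K * lp_norm p X f) powr p"
      using p_gt_1 lp_norm_nonneg[of p X "T f"] by (intro powr_mono2) auto
    then have "lpow p X (T f) \<le> K powr p * lpow p X f"
      by (simp add: powr_mult lp_norm_powr K_def lp_norm_nonneg)
    moreover have "(\<Sum>y\<in>Y. norm (T f y) powr p) \<le> lpow p X (T f)"
      using Y by (intro sum_le_lpow bounded_opr_lp[OF assms])
    ultimately show ?thesis by linarith
  qed
  then have "op_bound p X T K" by (simp add: op_bound_def)
  then show ?thesis by (rule that[rotated]) (simp add: K_def)
qed

lemma bounded_oprI:
  assumes out: "\<And>f. f \<notin> lp p X \<Longrightarrow> T f = 0"
    and off: "\<And>f x. x \<notin> X \<Longrightarrow> T f x = 0"
    and add: "\<And>f g x. f \<in> lp p X \<Longrightarrow> g \<in> lp p X \<Longrightarrow> T (f + g) x = T f x + T g x"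
    and scale: "\<And>c f x. f \<in> lp p X \<Longrightarrow> T (\<lambda>x. c * f x) x = c * T f x"
    and K: "op_bound p X T K" "K \<ge> 0"
  shows "T \<in> bounded_oprs p (count_space X)"
proof -
  have lp: "T f \<in> lp p X" if "f \<in> lp p X" for f
    using that off op_boundD[OF K(1)] by (intro lpI) auto
  moreover have "lp_norm p X (T f) \<le> K * lp_norm p X f" if "f \<in> lp p X" for f
    unfolding lp_norm_eq using that K op_boundD[OF K(1) that] lpow_nonneg
    by (intro powr_root_mono lpow_le lp) auto
  ultimately show ?thesis
    using assms unfolding bounded_oprs_def by (auto simp: fun_eq_iff)
qed

lemma bounded_opr_diff:
  assumes "S \<in> bounded_oprs p (count_space X)" "T \<in> bounded_oprs p (count_space X)"
  shows "S - T \<in> bounded_oprs p (count_space X)"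
proof -
  obtain K where K: "K \<ge> 0" "op_bound p X S K" using assms bounded_opr_op_bound by blast
  obtain L where L: "L \<ge> 0" "op_bound p X T L" using assms bounded_opr_op_bound by blast
  \<comment> \<open>\<open>M\<close> bounds \<open>p\<close>-th powers of norms, so the operator
    bound is its \<open>p\<close>-th root.\<close>
  define M where "M = 2 powr p * (K powr p + L powr p)"
  have "op_bound p X (S - T) (M powr (1 / p))"
    unfolding op_bound_def
  proof (intro allI impI)
    fix f Y assume f: "f \<in> lp p X" and Y: "finite Y" "Y \<subseteq> X"
    have "(\<Sum>y\<in>Y. norm ((S - T) f y) powr p) \<le>
        (\<Sum>y\<in>Y. 2 powr p * (norm (S f y) powr p + norm (T f y) powr p))"
      using powr_add_le[of "S f y" "- T f y" for y] by (intro sum_mono) simp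
    also have "\<dots> = 2 powr p * ((\<Sum>y\<in>Y. norm (S f y) powr p) + (\<Sum>y\<in>Y. norm (T f y) powr p))"
      by (simp add: sum.distrib flip: sum_distrib_left)
    also have "\<dots> \<le> 2 powr p * (K powr p * lpow p X f + L powr p * lpow p X f)"
      using K L f Y by (intro mult_left_mono add_mono op_boundD) auto
    also have "\<dots> = (M powr (1 / p)) powr p * lpow p X f"
      using p_gt_1 by (simp add: M_def powr_powr algebra_simps)
    finally show "(\<Sum>y\<in>Y. norm ((S - T) f y) powr p) \<le> (M powr (1 / p)) powr p * lpow p X f" .
  qed
  then show ?thesis
    using assms bounded_opr_lp[OF assms(1), THEN lp_support] bounded_opr_lp[OF assms(2), THEN lp_support]
    by (intro bounded_oprI[where K = "M powr (1 / p)"])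
       (auto simp: bounded_opr_add bounded_opr_scale bounded_opr_outside lp_support algebra_simps)
qed

section \<open>Matrix norms as least bounds\<close>

lemma sum_norm_eq: "sum_norm p (count_space X) k f = (\<Sum>i<k. lpow p X (f i)) powr (1 / p)"
  by (simp add: sum_norm_def lp_norm_powr)

lemma sum_norm_powr: "sum_norm p (count_space X) k f powr p = (\<Sum>i<k. lpow p X (f i))"
  using p_gt_1 by (simp add: sum_norm_eq powr_powr sum_nonneg lpow_nonneg)

lemma sum_norm_nonneg: "sum_norm p (count_space X) k f \<ge> 0"
  by (simp add: sum_norm_eq)

lemma sum_norm_scale:
  assumes "\<And>i. i < k \<Longrightarrow> f i \<in> lp p X" "s \<ge> 0"
  shows "sum_norm p (count_space X) k (\<lambda>i x. complex_of_real s * f i x) = s * sum_norm p (count_space X) k f"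
proof -
  have "sum_norm p (count_space X) k (\<lambda>i x. complex_of_real s * f i x) =
      (s powr p * (\<Sum>i<k. lpow p X (f i))) powr (1 / p)"
    using assms by (simp add: sum_norm_eq lp_scale sum_distrib_left)
  also have "\<dots> = s * sum_norm p (count_space X) k f"
    using assms(2) p_gt_1 by (simp add: sum_norm_eq powr_mult powr_powr sum_nonneg lpow_nonneg)
  finally show ?thesis .
qed

text \<open>Infinite sums of nonnegative terms are controlled by their finite partial sums, and one
  test set \<open>Y\<close> serves all \<open>k\<close> rows because the finite sum over rows
  commutes with the infinite one.\<close>

lemma mat_bound_iff_sum_norm:
  assumes a: "\<And>i j. i < k \<Longrightarrow> j < k \<Longrightarrow> a i j \<in> bounded_oprs p (count_space X)" and K: "K \<ge> 0"
  shows "mat_bound p X k a K \<longleftrightarrow> (\<forall>f. (\<forall>j<k. f j \<in> lp p X) \<longrightarrow>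
    sum_norm p (count_space X) k (\<lambda>i. \<Sum>j<k. a i j (f j)) \<le> K * sum_norm p (count_space X) k f)"
    (is "_ \<longleftrightarrow> ?R")
proof
  have lp: "(\<Sum>j<k. a i j (f j)) \<in> lp p X" if "i < k" for i f
    using that by (intro lp_sum bounded_opr_lp a) auto
  show ?R if m: "mat_bound p X k a K"
  proof (intro allI impI)
    fix f assume f: "\<forall>j<k. f j \<in> lp p X"
    have "(\<Sum>i<k. lpow p X (\<Sum>j<k. a i j (f j))) \<le> K powr p * (\<Sum>j<k. lpow p X (f j))"
    proof -
      have sm: "(\<lambda>y. norm (\<Sum>j<k. a i j (f j) y) powr p) summable_on X" if "i < k" for i
        using lp[OF that, of f] by (simp add: lp_iff_summable sum_fun_apply)
      have "(\<Sum>i<k. lpow p X (\<Sum>j<k. a i j (f j)))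
          = (\<Sum>i<k. infsum (\<lambda>y. norm (\<Sum>j<k. a i j (f j) y) powr p) X)"
        using lp by (intro sum.cong refl) (simp add: lpow_eq_infsum sum_fun_apply)
      also have "\<dots> = infsum (\<lambda>y. \<Sum>i<k. norm (\<Sum>j<k. a i j (f j) y) powr p) X"
        using sm by (intro infsumI[symmetric] has_sum_sum) auto
      also have "\<dots> \<le> K powr p * (\<Sum>j<k. lpow p X (f j))"
      proof (rule infsum_le_finite_sums)
        show "(\<lambda>y. \<Sum>i<k. norm (\<Sum>j<k. a i j (f j) y) powr p) summable_on X"
          using sm by (intro has_sum_imp_summable[OF has_sum_sum]) auto
        show "(\<Sum>y\<in>Y. \<Sum>i<k. norm (\<Sum>j<k. a i j (f j) y) powr p) \<le> K powr p * (\<Sum>j<k. lpow p X (f j))"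
          if "finite Y" "Y \<subseteq> X" for Y
          using mat_boundD[OF m _ that, of f] f by (subst sum.swap) auto
      qed
      finally show ?thesis .
    qed
    then show "sum_norm p (count_space X) k (\<lambda>i. \<Sum>j<k. a i j (f j)) \<le> K * sum_norm p (count_space X) k f"
      unfolding sum_norm_eq using K by (intro powr_root_mono) (auto intro!: sum_nonneg lpow_nonneg)
  qed
  show "mat_bound p X k a K" if R: ?R
    unfolding mat_bound_def
  proof (intro allI impI)
    fix f Y assume f: "\<forall>j<k. f j \<in> lp p X" and Y: "finite Y" "Y \<subseteq> X"
    have "(\<Sum>i<k. \<Sum>y\<in>Y. norm (\<Sum>j<k. a i j (f j) y) powr p) \<le> (\<Sum>i<k. lpow p X (\<Sum>j<k. a i j (f j)))"
      using sum_le_lpow[OF lp Y] by (intro sum_mono) (simp add: sum_fun_apply)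
    also have "\<dots> = sum_norm p (count_space X) k (\<lambda>i. \<Sum>j<k. a i j (f j)) powr p"
      by (simp add: sum_norm_powr)
    also have "\<dots> \<le> (K * sum_norm p (count_space X) k f) powr p"
      using R f p_gt_1 by (intro powr_mono2 sum_norm_nonneg) auto
    also have "\<dots> = K powr p * (\<Sum>j<k. lpow p X (f j))"
      using K by (simp add: powr_mult sum_norm_powr sum_norm_nonneg)
    finally show "(\<Sum>i<k. \<Sum>y\<in>Y. norm (\<Sum>j<k. a i j (f j) y) powr p) \<le> K powr p * (\<Sum>j<k. lpow p X (f j))" .
  qed
qed

text \<open>Only existence matters: it makes the set in \<open>matrix_norm\<close> bounded above,
  without which its \<open>Sup\<close> would carry no information.\<close>

lemma mat_bound_exists:
  assumes a: "\<And>i j. i < k \<Longrightarrow> j < k \<Longrightarrow> a i j \<in> bounded_oprs p (count_space X)"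
  obtains K where "K \<ge> 0" "mat_bound p X k a K"
proof -
  have "\<exists>K\<ge>0. op_bound p X (a i j) K" if "i < k" "j < k" for i j
    using bounded_opr_op_bound[OF a[OF that]] by blast
  then obtain B where B: "\<And>i j. i < k \<Longrightarrow> j < k \<Longrightarrow> B i j \<ge> 0 \<and> op_bound p X (a i j) (B i j)"
    by metis
  \<comment> \<open>\<open>L\<close> dominates the \<open>p\<close>-th power of every entry bound.
    In \<open>M\<close>, \<open>real k powr p\<close> comes from \<open>powr_sum_le\<close> and the
    other \<open>real k\<close> from adding equal bounds over the rows.\<close>
  define L where "L = (\<Sum>i<k. \<Sum>j<k. B i j powr p)"
  define M where "M = real k powr p * (real k * L)"
  have L0: "L \<ge> 0" by (auto simp: L_def intro!: sum_nonneg)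
  have BL: "B i j powr p \<le> L" if "i < k" "j < k" for i j
  proof -
    have "B i j powr p \<le> (\<Sum>j<k. B i j powr p)" using that by (intro member_le_sum) auto
    also have "\<dots> \<le> L" unfolding L_def using that
      by (intro member_le_sum[of i _ "\<lambda>i. \<Sum>j<k. B i j powr p"]) (auto intro!: sum_nonneg)
    finally show ?thesis .
  qed
  have "mat_bound p X k a (M powr (1 / p))"
    unfolding mat_bound_def
  proof (intro allI impI)
    fix f Y assume f: "\<forall>j<k. f j \<in> lp p X" and Y: "finite Y" "Y \<subseteq> X"
    have "(\<Sum>i<k. \<Sum>y\<in>Y. norm (\<Sum>j<k. a i j (f j) y) powr p)
      \<le> (\<Sum>i<k. \<Sum>y\<in>Y. real k powr p * (\<Sum>j<k. norm (a i j (f j) y) powr p))"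
      using powr_sum_le[of "{..<k}"] by (intro sum_mono) simp
    also have "\<dots> = real k powr p * (\<Sum>i<k. \<Sum>j<k. \<Sum>y\<in>Y. norm (a i j (f j) y) powr p)"
      by (subst (2) sum.swap) (simp add: sum_distrib_left)
    also have "\<dots> \<le> real k powr p * (\<Sum>i<k. \<Sum>j<k. L * lpow p X (f j))"
    proof (intro mult_left_mono sum_mono)
      fix i j assume ij: "i \<in> {..<k}" "j \<in> {..<k}"
      have "(\<Sum>y\<in>Y. norm (a i j (f j) y) powr p) \<le> B i j powr p * lpow p X (f j)"
        using ij B f Y by (intro op_boundD) auto
      also have "\<dots> \<le> L * lpow p X (f j)"
        using BL ij lpow_nonneg by (intro mult_right_mono) auto
      finally show "(\<Sum>y\<in>Y. norm (a i j (f j) y) powr p) \<le> L * lpow p X (f j)" .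
    qed simp
    also have "\<dots> = (M powr (1 / p)) powr p * (\<Sum>j<k. lpow p X (f j))"
      using L0 p_gt_1 by (simp add: M_def powr_powr sum_distrib_left mult.assoc)
    finally show "(\<Sum>i<k. \<Sum>y\<in>Y. norm (\<Sum>j<k. a i j (f j) y) powr p)
      \<le> (M powr (1 / p)) powr p * (\<Sum>j<k. lpow p X (f j))" .
  qed
  then show ?thesis by (rule that[rotated]) simp
qed

text \<open>The zero tuple keeps the set under the supremum nonempty and its supremum
  nonnegative.\<close>

lemma zero_in_matrix_norm_set:
  "sum_norm p (count_space X) k (\<lambda>i. \<Sum>j<k. a i j 0) \<in>
    {sum_norm p (count_space X) k (\<lambda>i. \<Sum>j<k. a i j (f j)) | f.
     (\<forall>j<k. f j \<in> lp p X) \<and> sum_norm p (count_space X) k f \<le> 1}"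
proof -
  have "sum_norm p (count_space X) k (\<lambda>_. 0) \<le> 1"
    using p_gt_1 by (simp add: sum_norm_eq lpow_def)
  then show ?thesis using lp_zero by (intro CollectI exI[of _ "\<lambda>_. 0"] conjI) auto
qed

lemma matrix_norm_le:
  assumes a: "\<And>i j. i < k \<Longrightarrow> j < k \<Longrightarrow> a i j \<in> bounded_oprs p (count_space X)"
    and K: "mat_bound p X k a K" "K \<ge> 0"
  shows "matrix_norm p (count_space X) k a \<le> K"
  unfolding matrix_norm_def
proof (rule cSup_least)
  show "{sum_norm p (count_space X) k (\<lambda>i. \<Sum>j<k. a i j (f j)) | f.
     (\<forall>j<k. f j \<in> lp p X) \<and> sum_norm p (count_space X) k f \<le> 1} \<noteq> {}"
    using zero_in_matrix_norm_set by blast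
  fix r assume "r \<in> {sum_norm p (count_space X) k (\<lambda>i. \<Sum>j<k. a i j (f j)) | f.
     (\<forall>j<k. f j \<in> lp p X) \<and> sum_norm p (count_space X) k f \<le> 1}"
  then obtain f where f: "\<forall>j<k. f j \<in> lp p X" "sum_norm p (count_space X) k f \<le> 1"
    "r = sum_norm p (count_space X) k (\<lambda>i. \<Sum>j<k. a i j (f j))" by blast
  then have "r \<le> K * sum_norm p (count_space X) k f"
    using mat_bound_iff_sum_norm[OF a K(2)] K(1) by simp
  also have "\<dots> \<le> K * 1" using f K by (intro mult_left_mono) auto
  finally show "r \<le> K" by simp
qed

text \<open>Together with \<open>matrix_norm_le\<close> this makes \<open>matrix_norm\<close> the
  least bound. Tuples in the unit ball obey the supremum, and homogeneity carries this over to all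
  tuples.\<close>

lemma mat_bound_matrix_norm:
  assumes a: "\<And>i j. i < k \<Longrightarrow> j < k \<Longrightarrow> a i j \<in> bounded_oprs p (count_space X)"
  shows "matrix_norm p (count_space X) k a \<ge> 0" "mat_bound p X k a (matrix_norm p (count_space X) k a)"
proof -
  let ?S = "{sum_norm p (count_space X) k (\<lambda>i. \<Sum>j<k. a i j (f j)) | f.
     (\<forall>j<k. f j \<in> lp p X) \<and> sum_norm p (count_space X) k f \<le> 1}"
  obtain M where M: "M \<ge> 0" "mat_bound p X k a M" by (rule mat_bound_exists[OF a])
  then have Mf: "sum_norm p (count_space X) k (\<lambda>i. \<Sum>j<k. a i j (f j)) \<le> M * sum_norm p (count_space X) k f"
    if "\<forall>j<k. f j \<in> lp p X" for f
    using mat_bound_iff_sum_norm[OF a M(1)] M(2) that by simp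
  have bdd: "bdd_above ?S"
  proof (rule bdd_aboveI[where M = M])
    fix r assume "r \<in> ?S"
    then obtain f where f: "\<forall>j<k. f j \<in> lp p X" "sum_norm p (count_space X) k f \<le> 1"
      "r = sum_norm p (count_space X) k (\<lambda>i. \<Sum>j<k. a i j (f j))" by blast
    then have "r \<le> M * sum_norm p (count_space X) k f" using Mf by blast
    also have "\<dots> \<le> M * 1" using f M by (intro mult_left_mono) auto
    finally show "r \<le> M" by simp
  qed
  have mem: "sum_norm p (count_space X) k (\<lambda>i. \<Sum>j<k. a i j (f j)) \<le> matrix_norm p (count_space X) k a"
    if "\<forall>j<k. f j \<in> lp p X" "sum_norm p (count_space X) k f \<le> 1" for f
    unfolding matrix_norm_def using that by (intro cSup_upper bdd CollectI exI[of _ f] conjI) auto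
  have "0 \<le> sum_norm p (count_space X) k (\<lambda>i. \<Sum>j<k. a i j 0)"
    by (rule sum_norm_nonneg)
  also have "\<dots> \<le> matrix_norm p (count_space X) k a"
    unfolding matrix_norm_def by (intro cSup_upper bdd zero_in_matrix_norm_set)
  finally show nn: "matrix_norm p (count_space X) k a \<ge> 0" .
  have "sum_norm p (count_space X) k (\<lambda>i. \<Sum>j<k. a i j (f j))
      \<le> matrix_norm p (count_space X) k a * sum_norm p (count_space X) k f"
    if f: "\<forall>j<k. f j \<in> lp p X" for f
  proof (cases "sum_norm p (count_space X) k f = 0")
    \<comment> \<open>A tuple of norm zero cannot be normalized; the a priori bound \<open>M\<close>
      makes its image zero as well.\<close>
    case True
    with Mf[OF f] show ?thesis by simp
  next
    case False
    define s where "s = sum_norm p (count_space X) k f"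
    have s: "s > 0" using False sum_norm_nonneg[of X k f] by (simp add: s_def)
    let ?g = "\<lambda>j x. complex_of_real (1 / s) * f j x"
    have "sum_norm p (count_space X) k (\<lambda>i. \<Sum>j<k. a i j (?g j)) \<le> matrix_norm p (count_space X) k a"
    proof (rule mem)
      show "\<forall>j<k. ?g j \<in> lp p X" using f lp_scale by blast
      show "sum_norm p (count_space X) k ?g \<le> 1"
        using sum_norm_scale[of k f X "1 / s"] f s by (simp add: s_def)
    qed
    also have "sum_norm p (count_space X) k (\<lambda>i. \<Sum>j<k. a i j (?g j))
      = sum_norm p (count_space X) k (\<lambda>i x. complex_of_real (1 / s) * (\<Sum>j<k. a i j (f j)) x)"
    proof -
      have "(\<Sum>j<k. a i j (?g j)) = (\<lambda>x. complex_of_real (1 / s) * (\<Sum>j<k. a i j (f j)) x)" if "i < k" for i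
      proof -
        have "a i j (?g j) = (\<lambda>x. complex_of_real (1 / s) * a i j (f j) x)" if "j < k" for j
          using f \<open>i < k\<close> that by (intro bounded_opr_scale[OF a]) auto
        then show ?thesis by (auto simp: fun_eq_iff sum_fun_apply sum_distrib_left intro!: sum.cong)
      qed
      then show ?thesis by (simp add: sum_norm_eq)
    qed
    also have "\<dots> = 1 / s * sum_norm p (count_space X) k (\<lambda>i. \<Sum>j<k. a i j (f j))"
      using s by (intro sum_norm_scale lp_sum bounded_opr_lp a) auto
    finally show ?thesis using s by (simp add: field_simps s_def)
  qed
  then show "mat_bound p X k a (matrix_norm p (count_space X) k a)"
    using mat_bound_iff_sum_norm[OF a nn] by simp
qed

lemma opr_norm_eq_matrix_norm:
  "opr_norm p (count_space X) T = matrix_norm p (count_space X) 1 (\<lambda>_ _. T)"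
proof -
  have [simp]: "sum_norm p (count_space X) (Suc 0) f = lp_norm p X (f 0)" for f
    by (simp add: sum_norm_eq lp_norm_eq)
  have "(\<exists>f. r = lp_norm p X (T f) \<and> f \<in> lp p X \<and> lp_norm p X f \<le> 1) \<longleftrightarrow>
    (\<exists>f. r = lp_norm p X (T (f 0)) \<and> f (0::nat) \<in> lp p X \<and> lp_norm p X (f 0) \<le> 1)" for r
    using ex_comp_surj[of "\<lambda>f :: nat \<Rightarrow> _. f 0" "\<lambda>f. r = lp_norm p X (T f) \<and> f \<in> lp p X \<and> lp_norm p X f \<le> 1"]
    by (simp add: surjI[where f = "\<lambda>f _. f"])
  then have "opr_norm p (count_space X) T =
    Sup {lp_norm p X (T (f 0)) | f. f (0::nat) \<in> lp p X \<and> lp_norm p X (f 0) \<le> 1}"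
    unfolding opr_norm_def by (intro arg_cong[where f = Sup] Collect_cong)
  also have "\<dots> = matrix_norm p (count_space X) 1 (\<lambda>_ _. T)"
    by (simp add: matrix_norm_def)
  finally show ?thesis .
qed

lemma opr_norm_le:
  assumes "T \<in> bounded_oprs p (count_space X)" "op_bound p X T K" "K \<ge> 0"
  shows "opr_norm p (count_space X) T \<le> K"
  unfolding opr_norm_eq_matrix_norm
  by (rule matrix_norm_le[where a = "\<lambda>_ _. T"]) (use assms in \<open>simp_all add: op_bound_iff_mat_bound\<close>)

lemma op_bound_opr_norm:
  assumes "T \<in> bounded_oprs p (count_space X)"
  shows "op_bound p X T (opr_norm p (count_space X) T)"
  unfolding opr_norm_eq_matrix_norm op_bound_iff_mat_bound
  by (rule mat_bound_matrix_norm(2)[where a = "\<lambda>_ _. T"]) (rule assms)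

lemma op_bound_mono: "op_bound p X T K \<Longrightarrow> 0 \<le> K \<Longrightarrow> K \<le> L \<Longrightarrow> op_bound p X T L"
proof -
  assume K: "op_bound p X T K" "0 \<le> K" "K \<le> L"
  then have "K powr p * lpow p X f \<le> L powr p * lpow p X f" for f
    using p_gt_1 by (intro mult_right_mono powr_mono2 lpow_nonneg) auto
  then show ?thesis
    unfolding op_bound_def by (intro allI impI order_trans[OF op_boundD[OF K(1)]]) auto
qed

lemma opr_norm_nonneg: "T \<in> bounded_oprs p (count_space X) \<Longrightarrow> opr_norm p (count_space X) T \<ge> 0"
  unfolding opr_norm_eq_matrix_norm by (rule mat_bound_matrix_norm(1)[where a = "\<lambda>_ _. T"])

text \<open>The constant \<open>4\<close> instead of \<open>2\<close> avoids Minkowski's inequality.\<close>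
lemma op_bound_add:
  assumes "op_bound p X S K" "op_bound p X T K" "K \<ge> 0"
    and V: "\<And>f y. f \<in> lp p X \<Longrightarrow> y \<in> X \<Longrightarrow> V f y = S f y + T f y"
  shows "op_bound p X V (4 * K)"
  unfolding op_bound_def
proof (intro allI impI)
  fix f Y assume f: "f \<in> lp p X" and Y: "finite Y" "Y \<subseteq> X"
  have "(\<Sum>y\<in>Y. norm (V f y) powr p) \<le> (\<Sum>y\<in>Y. 2 powr p * (norm (S f y) powr p + norm (T f y) powr p))"
    using V[OF f] Y powr_add_le by (intro sum_mono) (auto simp: subset_iff)
  also have "\<dots> = 2 powr p * ((\<Sum>y\<in>Y. norm (S f y) powr p) + (\<Sum>y\<in>Y. norm (T f y) powr p))"
    by (simp add: sum.distrib flip: sum_distrib_left)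
  also have "\<dots> \<le> 2 powr p * (K powr p * lpow p X f + K powr p * lpow p X f)"
    using assms f Y by (intro mult_left_mono add_mono op_boundD) auto
  \<comment> \<open>The 2 from two equal terms is at most \<open>2 powr p\<close> since
    \<open>p > 1\<close>, so the constants combine to \<open>4 powr p\<close>.\<close>
  also have "\<dots> = 2 powr p * (2 powr 1) * (K powr p * lpow p X f)"
    by simp
  also have "\<dots> \<le> 2 powr p * 2 powr p * (K powr p * lpow p X f)"
    using p_gt_1 lpow_nonneg[of p X f] by (intro mult_right_mono mult_left_mono powr_mono mult_nonneg_nonneg) auto
  also have "\<dots> = (4 * K) powr p * lpow p X f"
    using assms(3) powr_mult[of 2 2 p] by (simp add: powr_mult)
  finally show "(\<Sum>y\<in>Y. norm (V f y) powr p) \<le> (4 * K) powr p * lpow p X f" .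
qed

end

section \<open>Reassembling and compressing blocks\<close>

text \<open>\<open>B x\<close> abstracts the part in \<open>X\<close> of a ball of fixed radius.
  Symmetry of the metric enters as \<open>B_sym\<close>, by which sums over pairs of a point and a
  centre are reordered.\<close>

locale roe_blocks = exponent +
  fixes X :: "'a set" and B :: "'a \<Rightarrow> 'a set"
  assumes B_subset: "x \<in> X \<Longrightarrow> B x \<subseteq> X"
    and finite_B: "x \<in> X \<Longrightarrow> finite (B x)"
    and B_sym: "x \<in> X \<Longrightarrow> y \<in> X \<Longrightarrow> y \<in> B x \<longleftrightarrow> x \<in> B y"

text \<open>\<open>w y x\<close> is the coordinate at \<open>x\<close> of the vector attached to
  \<open>y\<close>. The bound \<open>w_sum\<close> acts twice: on the dual weights in row
  \<open>y\<close>, and on the total mass that all balls together give to an input point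
  \<open>z\<close>.\<close>

locale block_synthesis = roe_blocks +
  fixes w :: "'a \<Rightarrow> 'a \<Rightarrow> real" and n :: nat and \<tau> :: "'a \<Rightarrow> 'a \<Rightarrow> nat"
  assumes w_nonneg: "y \<in> X \<Longrightarrow> w y x \<ge> 0"
    and w_sum: "y \<in> X \<Longrightarrow> (\<Sum>x\<in>B y. w y x powr p) \<le> 1"
    and inj_\<tau>: "x \<in> X \<Longrightarrow> inj_on (\<tau> x) (B x)"
    and \<tau>_less: "x \<in> X \<Longrightarrow> y \<in> B x \<Longrightarrow> \<tau> x y < n"
begin

text \<open>\<open>\<tau> x\<close> places the ball \<open>B x\<close> among the coordinates \<open>0, \<dots>, n - 1\<close>; different balls may share
  coordinates.\<close>
definition transport :: "'a \<Rightarrow> ('a \<Rightarrow> complex) \<Rightarrow> nat \<Rightarrow> complex" where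
  "transport x f t = (if t \<in> \<tau> x ` B x
     then complex_of_real (w (the_inv_into (B x) (\<tau> x) t) x) * f (the_inv_into (B x) (\<tau> x) t) else 0)"

text \<open>The same \<open>b\<close> acts in every ball, between the weighted embedding
  \<open>transport\<close> and the dual weights \<open>w y x powr (p - 1)\<close>.\<close>

definition synth :: "nat opr \<Rightarrow> 'a opr" where
  "synth b f y = (if f \<in> lp p X \<and> y \<in> X
     then \<Sum>x\<in>B y. complex_of_real (w y x powr (p - 1)) * b (transport x f) (\<tau> x y) else 0)"

lemma transport_\<tau>:
  "x \<in> X \<Longrightarrow> z \<in> B x \<Longrightarrow> transport x f (\<tau> x z) = complex_of_real (w z x) * f z"
  using the_inv_into_f_f[OF inj_\<tau>] by (simp add: transport_def)

lemma transport_lp: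
  assumes "x \<in> X"
  shows "transport x f \<in> lp p {..<n}"
    "lpow p {..<n} (transport x f) = (\<Sum>z\<in>B x. w z x powr p * norm (f z) powr p)"
proof -
  have fin: "finite (\<tau> x ` B x)" "\<tau> x ` B x \<subseteq> {..<n}"
    using finite_B \<tau>_less assms by auto
  have zero: "transport x f t = 0" if "t \<notin> \<tau> x ` B x" for t
    using that by (simp add: transport_def)
  show "transport x f \<in> lp p {..<n}"
    using lp_finite_support(1)[OF fin zero] by simp
  have "lpow p {..<n} (transport x f) = (\<Sum>t\<in>\<tau> x ` B x. norm (transport x f t) powr p)"
    using lp_finite_support(2)[OF fin zero] by simp
  also have "\<dots> = (\<Sum>z\<in>B x. norm (transport x f (\<tau> x z)) powr p)"
    using inj_\<tau>[OF assms] by (simp add: sum.reindex)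
  also have "\<dots> = (\<Sum>z\<in>B x. w z x powr p * norm (f z) powr p)"
    using assms B_subset w_nonneg
    by (intro sum.cong) (auto simp: transport_\<tau> norm_mult powr_mult subset_iff)
  finally show "lpow p {..<n} (transport x f) = (\<Sum>z\<in>B x. w z x powr p * norm (f z) powr p)" .
qed

lemma transport_add: "transport x (f + g) = transport x f + transport x g"
  by (auto simp: transport_def fun_eq_iff algebra_simps)

lemma transport_scale: "transport x (\<lambda>z. c * f z) = (\<lambda>t. c * transport x f t)"
  by (auto simp: transport_def fun_eq_iff)

lemma synth_add: "synth (a + b) = synth a + synth b"
  by (auto simp: synth_def fun_eq_iff sum.distrib algebra_simps)

lemma synth_diff: "synth (a - b) = synth a - synth b"
  by (auto simp: synth_def fun_eq_iff sum_subtractf algebra_simps)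

lemma synth_scale: "synth (\<lambda>f x. c * a f x) = (\<lambda>f x. c * synth a f x)"
  by (auto simp: synth_def fun_eq_iff sum_distrib_left algebra_simps)

text \<open>Hoelder's inequality in each row \<open>y\<close> removes the dual weights. What remains
  is one copy of \<open>b\<close> per centre \<open>x\<close>, each bounded by \<open>K\<close>, and
  \<open>w_sum\<close> bounds the total mass of the embedded inputs. The row index \<open>i\<close>
  is carried along throughout, which gives complete contractivity.\<close>

lemma synth_mat_bound:
  assumes b: "mat_bound p {..<n} k b K"
  shows "mat_bound p X k (\<lambda>i j. synth (b i j)) K"
  unfolding mat_bound_def
proof (intro allI impI)
  fix f Y assume f: "\<forall>j<k. f j \<in> lp p X" and Y: "finite Y" "Y \<subseteq> X"
  \<comment> \<open>The balls that meet \<open>Y\<close> have their centres in \<open>G\<close>, and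
    \<open>H\<close> contains all points of these balls; this keeps every sum finite.\<close>
  define G where "G = (\<Union>y\<in>Y. B y)"
  define H where "H = (\<Union>x\<in>G. B x)"
  define u where "u i x t = (\<Sum>j<k. b i j (transport x (f j)) t)" for i x t
  have G: "finite G" "G \<subseteq> X"
    unfolding G_def using Y finite_B B_subset by (blast intro: finite_UN_I)+
  have H: "finite H" "H \<subseteq> X"
    unfolding H_def using G finite_B B_subset by (blast intro: finite_UN_I)+
  have "(\<Sum>i<k. \<Sum>y\<in>Y. norm (\<Sum>j<k. synth (b i j) (f j) y) powr p)
      \<le> (\<Sum>i<k. \<Sum>y\<in>Y. \<Sum>x\<in>B y. norm (u i x (\<tau> x y)) powr p)"
  proof (intro sum_mono)
    fix i y assume i: "i \<in> {..<k}" and y: "y \<in> Y"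
    have "(\<Sum>j<k. synth (b i j) (f j) y)
        = (\<Sum>j<k. \<Sum>x\<in>B y. complex_of_real (w y x powr (p - 1)) * b i j (transport x (f j)) (\<tau> x y))"
      using f y Y by (intro sum.cong) (auto simp: synth_def)
    also have "\<dots> = (\<Sum>x\<in>B y. complex_of_real (w y x powr (p - 1)) * u i x (\<tau> x y))"
      by (subst sum.swap) (simp add: u_def sum_distrib_left)
    finally show "norm (\<Sum>j<k. synth (b i j) (f j) y) powr p \<le> (\<Sum>x\<in>B y. norm (u i x (\<tau> x y)) powr p)"
      using y Y by (auto intro!: Hoelder_weight finite_B w_nonneg w_sum)
  qed
  \<comment> \<open>Pairs of a point and a centre are regrouped by centre, using
    \<open>B_sym\<close>.\<close>
  also have "\<dots> = (\<Sum>i<k. \<Sum>x\<in>G. \<Sum>y\<in>{y\<in>Y. y \<in> B x}. norm (u i x (\<tau> x y)) powr p)"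
  proof (rule sum.cong[OF refl])
    fix i
    have "(\<Sum>y\<in>Y. \<Sum>x\<in>B y. norm (u i x (\<tau> x y)) powr p)
        = (\<Sum>y\<in>Y. \<Sum>x\<in>{x\<in>G. y \<in> B x}. norm (u i x (\<tau> x y)) powr p)"
    proof (rule sum.cong[OF refl])
      fix y assume "y \<in> Y"
      then have "x \<in> B y \<longleftrightarrow> x \<in> G \<and> y \<in> B x" for x
        using Y(2) G(2) B_sym[of x y] B_subset[of y] unfolding G_def by blast
      then have "B y = {x \<in> G. y \<in> B x}" by blast
      then show "(\<Sum>x\<in>B y. norm (u i x (\<tau> x y)) powr p) = (\<Sum>x\<in>{x\<in>G. y \<in> B x}. norm (u i x (\<tau> x y)) powr p)"
        by simp
    qed
    also have "\<dots> = (\<Sum>x\<in>G. \<Sum>y\<in>{y\<in>Y. y \<in> B x}. norm (u i x (\<tau> x y)) powr p)"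
      by (rule sum.swap_restrict[OF Y(1) G(1)])
    finally show "(\<Sum>y\<in>Y. \<Sum>x\<in>B y. norm (u i x (\<tau> x y)) powr p)
        = (\<Sum>x\<in>G. \<Sum>y\<in>{y\<in>Y. y \<in> B x}. norm (u i x (\<tau> x y)) powr p)" .
  qed
  \<comment> \<open>By injectivity of \<open>\<tau> x\<close> the points of \<open>Y\<close> in the
    ball occupy distinct coordinates below \<open>n\<close>; further coordinates only add to the
    sum.\<close>
  also have "\<dots> \<le> (\<Sum>i<k. \<Sum>x\<in>G. \<Sum>t<n. norm (u i x t) powr p)"
  proof (intro sum_mono)
    fix i x assume "x \<in> G"
    then have x: "x \<in> X" using G by auto
    have "(\<Sum>y\<in>{y\<in>Y. y \<in> B x}. norm (u i x (\<tau> x y)) powr p)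
        = (\<Sum>t\<in>\<tau> x ` {y\<in>Y. y \<in> B x}. norm (u i x t) powr p)"
      using inj_\<tau>[OF x] by (subst sum.reindex) (auto intro: inj_on_subset)
    also have "\<dots> \<le> (\<Sum>t<n. norm (u i x t) powr p)"
      using \<tau>_less[OF x] by (intro sum_mono2) auto
    finally show "(\<Sum>y\<in>{y\<in>Y. y \<in> B x}. norm (u i x (\<tau> x y)) powr p) \<le> (\<Sum>t<n. norm (u i x t) powr p)" .
  qed
  also have "\<dots> = (\<Sum>x\<in>G. \<Sum>i<k. \<Sum>t<n. norm (u i x t) powr p)"
    by (rule sum.swap)
  also have "\<dots> \<le> (\<Sum>x\<in>G. K powr p * (\<Sum>j<k. lpow p {..<n} (transport x (f j))))"
    unfolding u_def using G by (intro sum_mono mat_boundD[OF b] transport_lp(1)) auto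
  also have "\<dots> = K powr p * (\<Sum>j<k. \<Sum>x\<in>G. \<Sum>z\<in>B x. w z x powr p * norm (f j z) powr p)"
    using G by (subst sum.swap) (auto simp: sum_distrib_left transport_lp(2) subset_iff intro!: sum.cong)
  \<comment> \<open>Regrouped by points \<open>z\<close>, the weights add up to at most 1 for each
    \<open>z\<close>.\<close>
  also have "\<dots> \<le> K powr p * (\<Sum>j<k. lpow p X (f j))"
  proof (intro mult_left_mono sum_mono)
    fix j assume j: "j \<in> {..<k}"
    have "(\<Sum>x\<in>G. \<Sum>z\<in>B x. w z x powr p * norm (f j z) powr p)
        = (\<Sum>x\<in>G. \<Sum>z\<in>{z\<in>H. z \<in> B x}. w z x powr p * norm (f j z) powr p)"
      by (intro sum.cong) (auto simp: H_def)
    also have "\<dots> = (\<Sum>z\<in>H. \<Sum>x\<in>{x\<in>G. z \<in> B x}. w z x powr p * norm (f j z) powr p)"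
      by (rule sum.swap_restrict[OF G(1) H(1)])
    also have "\<dots> \<le> (\<Sum>z\<in>H. norm (f j z) powr p)"
    proof (rule sum_mono)
      fix z assume "z \<in> H"
      then have z: "z \<in> X" using H by auto
      have "(\<Sum>x\<in>{x\<in>G. z \<in> B x}. w z x powr p) \<le> (\<Sum>x\<in>B z. w z x powr p)"
        using z G B_sym finite_B by (intro sum_mono2) auto
      also have "\<dots> \<le> 1" by (rule w_sum[OF z])
      finally show "(\<Sum>x\<in>{x\<in>G. z \<in> B x}. w z x powr p * norm (f j z) powr p) \<le> norm (f j z) powr p"
        by (simp add: mult_left_le_one_le sum_nonneg flip: sum_distrib_right)
    qed
    also have "\<dots> \<le> lpow p X (f j)"
      using f j H by (intro sum_le_lpow) auto
    finally show "(\<Sum>x\<in>G. \<Sum>z\<in>B x. w z x powr p * norm (f j z) powr p) \<le> lpow p X (f j)" .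
  qed simp
  finally show "(\<Sum>i<k. \<Sum>y\<in>Y. norm (\<Sum>j<k. synth (b i j) (f j) y) powr p) \<le> K powr p * (\<Sum>j<k. lpow p X (f j))" .
qed

lemma synth_op_bound: "op_bound p {..<n} b K \<Longrightarrow> op_bound p X (synth b) K"
  using synth_mat_bound[of 1 "\<lambda>_ _. b" K] by (simp add: op_bound_iff_mat_bound)

lemma synth_bounded_opr:
  assumes b: "b \<in> Mnp p n"
  shows "synth b \<in> bounded_oprs p (count_space X)"
proof -
  obtain K where K: "K \<ge> 0" "op_bound p {..<n} b K" using bounded_opr_op_bound[OF b] by blast
  have t: "x \<in> X" if "y \<in> X" "x \<in> B y" for x y using that B_subset by auto
  show ?thesis
  proof (rule bounded_oprI)
    fix f g y assume fg: "f \<in> lp p X" "g \<in> lp p X"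
    have "(\<Sum>x\<in>B y. complex_of_real (w y x powr (p - 1)) * b (transport x (f + g)) (\<tau> x y))
        = (\<Sum>x\<in>B y. complex_of_real (w y x powr (p - 1)) * b (transport x f) (\<tau> x y)
          + complex_of_real (w y x powr (p - 1)) * b (transport x g) (\<tau> x y))" if "y \<in> X"
      using t[OF that]
      by (intro sum.cong refl)
        (simp add: transport_add bounded_opr_add[OF b transport_lp(1) transport_lp(1)] distrib_left)
    then show "synth b (f + g) y = synth b f y + synth b g y"
      using fg lp_add[OF fg] by (simp add: synth_def sum.distrib)
  next
    fix c f y assume f: "f \<in> lp p X"
    have "(\<Sum>x\<in>B y. complex_of_real (w y x powr (p - 1)) * b (transport x (\<lambda>x. c * f x)) (\<tau> x y))
        = (\<Sum>x\<in>B y. c * (complex_of_real (w y x powr (p - 1)) * b (transport x f) (\<tau> x y)))" if "y \<in> X"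
      using t[OF that]
      by (intro sum.cong refl) (simp add: transport_scale bounded_opr_scale[OF b transport_lp(1)])
    then show "synth b (\<lambda>x. c * f x) y = c * synth b f y"
      using f lp_scale(1)[OF f] by (simp add: synth_def sum_distrib_left)
  qed (auto simp: synth_def fun_eq_iff intro: synth_op_bound K)
qed

end

text \<open>The coordinates \<open>s < m\<close> enumerate the pairs \<open>(c, y)\<close> with \<open>y \<in> B c\<close>; the rest, present so that
  \<open>n \<ge> 1\<close> even if \<open>X\<close> is empty, are not used.\<close>
locale block_compression = roe_blocks +
  fixes C :: "'a set" and m n :: nat and h :: "nat \<Rightarrow> 'a \<times> 'a" and g :: "'a \<times> 'a \<Rightarrow> nat"
  assumes C_subset: "C \<subseteq> X" and finite_C: "finite C" and m_le: "m \<le> n"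
    and h_bij: "bij_betw h {..<m} (Sigma C B)"
    and g_h: "s < m \<Longrightarrow> g (h s) = s"
begin

lemma h_g: "h (g q) = q" and g_less: "g q < m" if "q \<in> Sigma C B"
proof -
  from that h_bij obtain s where "s < m" "q = h s"
    unfolding bij_betw_def by (metis imageE lessThan_iff)
  then show "h (g q) = q" "g q < m" by (simp_all add: g_h)
qed

lemma h_in: "s < m \<Longrightarrow> h s \<in> Sigma C B"
  using bij_betwE[OF h_bij] by blast

lemma g_bij: "bij_betw g (Sigma C B) {..<m}"
  by (rule bij_betw_byWitness[where f' = h]) (use h_g g_less h_in g_h in blast)+

definition slice :: "'a \<Rightarrow> (nat \<Rightarrow> complex) \<Rightarrow> 'a \<Rightarrow> complex" where
  "slice c f y = (if y \<in> B c then f (g (c, y)) else 0)"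

text \<open>Coordinate \<open>(c, y)\<close> of the output sees only the slice at the same
  \<open>c\<close>, so the result is block-diagonal, its blocks being the compressions of
  \<open>a\<close> to the balls \<open>B c\<close>.\<close>

definition compress :: "'a opr \<Rightarrow> nat opr" where
  "compress a f s = (if f \<in> lp p {..<n} \<and> s < m then a (slice (fst (h s)) f) (snd (h s)) else 0)"

lemma compress_g:
  "f \<in> lp p {..<n} \<Longrightarrow> c \<in> C \<Longrightarrow> y \<in> B c \<Longrightarrow> compress a f (g (c, y)) = a (slice c f) y"
  using h_g[of "(c, y)"] g_less[of "(c, y)"] by (simp add: compress_def)

lemma slice_lp:
  assumes "c \<in> C"
  shows "slice c f \<in> lp p X" "lpow p X (slice c f) = (\<Sum>y\<in>B c. norm (f (g (c, y))) powr p)"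
proof -
  have fin: "finite (B c)" "B c \<subseteq> X" using assms C_subset finite_B B_subset by auto
  have z: "slice c f y = 0" if "y \<notin> B c" for y using that by (simp add: slice_def)
  show "slice c f \<in> lp p X" by (rule lp_finite_support(1)[OF fin z])
  show "lpow p X (slice c f) = (\<Sum>y\<in>B c. norm (f (g (c, y))) powr p)"
    by (subst lp_finite_support(2)[OF fin z]) (auto simp: slice_def)
qed

lemma slice_add: "slice c (f + f') = slice c f + slice c f'"
  by (auto simp: slice_def)

lemma slice_scale: "slice c (\<lambda>x. r * f x) = (\<lambda>x. r * slice c f x)"
  by (auto simp: slice_def)

lemma compress_add: "compress (a + b) = compress a + compress b"
  by (auto simp: compress_def fun_eq_iff)

lemma compress_diff: "compress (a - b) = compress a - compress b"
  by (auto simp: compress_def fun_eq_iff)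

lemma compress_scale: "compress (\<lambda>f x. c * a f x) = (\<lambda>f x. c * compress a f x)"
  by (auto simp: compress_def fun_eq_iff)

text \<open>Each block is a compression of \<open>a\<close> and obeys its bound \<open>K\<close>.
  Balls may overlap in \<open>X\<close>, but their copies occupy disjoint coordinates, so
  \<open>p\<close>-th powers add over \<open>c\<close>.\<close>

lemma compress_mat_bound:
  assumes a: "mat_bound p X k a K"
  shows "mat_bound p {..<n} k (\<lambda>i j. compress (a i j)) K"
  unfolding mat_bound_def
proof (intro allI impI)
  fix f Y assume f: "\<forall>j<k. f j \<in> lp p {..<n}" and Y: "finite Y" "Y \<subseteq> {..<n}"
  let ?u = "\<lambda>i s. norm (\<Sum>j<k. compress (a i j) (f j) s) powr p"
  have fB: "\<forall>c\<in>C. finite (B c)" using C_subset finite_B by auto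
  have "(\<Sum>i<k. \<Sum>s\<in>Y. ?u i s) \<le> (\<Sum>i<k. \<Sum>s<m. ?u i s)"
  proof (rule sum_mono)
    fix i
    have "(\<Sum>s\<in>Y. ?u i s) = (\<Sum>s\<in>Y \<inter> {..<m}. ?u i s)"
      using Y by (intro sum.mono_neutral_right) (auto simp: compress_def)
    also have "\<dots> \<le> (\<Sum>s<m. ?u i s)" by (intro sum_mono2) auto
    finally show "(\<Sum>s\<in>Y. ?u i s) \<le> (\<Sum>s<m. ?u i s)" .
  qed
  also have "\<dots> = (\<Sum>i<k. \<Sum>c\<in>C. \<Sum>y\<in>B c. ?u i (g (c, y)))"
  proof (rule sum.cong[OF refl])
    fix i
    have "(\<Sum>s<m. ?u i s) = (\<Sum>q\<in>Sigma C B. ?u i (g q))"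
      using sum.reindex_bij_betw[OF g_bij, of "?u i"] by simp
    also have "\<dots> = (\<Sum>c\<in>C. \<Sum>y\<in>B c. ?u i (g (c, y)))"
      using sum.Sigma[OF finite_C fB, of "\<lambda>c y. ?u i (g (c, y))"] by (simp add: case_prod_beta)
    finally show "(\<Sum>s<m. ?u i s) = (\<Sum>c\<in>C. \<Sum>y\<in>B c. ?u i (g (c, y)))" .
  qed
  also have "\<dots> = (\<Sum>i<k. \<Sum>c\<in>C. \<Sum>y\<in>B c. norm (\<Sum>j<k. a i j (slice c (f j)) y) powr p)"
    using f by (intro sum.cong refl arg_cong[where f = "\<lambda>z. norm z powr p"]) (auto simp: compress_g)
  also have "\<dots> = (\<Sum>c\<in>C. \<Sum>i<k. \<Sum>y\<in>B c. norm (\<Sum>j<k. a i j (slice c (f j)) y) powr p)"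
    by (rule sum.swap)
  also have "\<dots> \<le> (\<Sum>c\<in>C. K powr p * (\<Sum>j<k. lpow p X (slice c (f j))))"
    using C_subset finite_B B_subset by (intro sum_mono mat_boundD[OF a] slice_lp(1)) auto
  also have "\<dots> = K powr p * (\<Sum>j<k. \<Sum>c\<in>C. \<Sum>y\<in>B c. norm (f j (g (c, y))) powr p)"
    by (subst sum.swap) (auto simp: sum_distrib_left slice_lp(2) intro!: sum.cong)
  also have "\<dots> \<le> K powr p * (\<Sum>j<k. lpow p {..<n} (f j))"
  proof (intro mult_left_mono sum_mono)
    fix j assume j: "j \<in> {..<k}"
    have "(\<Sum>c\<in>C. \<Sum>y\<in>B c. norm (f j (g (c, y))) powr p) = (\<Sum>q\<in>Sigma C B. norm (f j (g q)) powr p)"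
      using sum.Sigma[OF finite_C fB, of "\<lambda>c y. norm (f j (g (c, y))) powr p"] by (simp add: case_prod_beta)
    also have "\<dots> = (\<Sum>s<m. norm (f j s) powr p)"
      using sum.reindex_bij_betw[OF g_bij, of "\<lambda>s. norm (f j s) powr p"] by simp
    also have "\<dots> \<le> lpow p {..<n} (f j)"
      using f j m_le by (intro sum_le_lpow) auto
    finally show "(\<Sum>c\<in>C. \<Sum>y\<in>B c. norm (f j (g (c, y))) powr p) \<le> lpow p {..<n} (f j)" .
  qed simp
  finally show "(\<Sum>i<k. \<Sum>s\<in>Y. ?u i s) \<le> K powr p * (\<Sum>j<k. lpow p {..<n} (f j))" .
qed

lemma compress_op_bound: "op_bound p X a K \<Longrightarrow> op_bound p {..<n} (compress a) K"
  using compress_mat_bound[of 1 "\<lambda>_ _. a" K] by (simp add: op_bound_iff_mat_bound)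

lemma compress_bounded_opr:
  assumes a: "a \<in> bounded_oprs p (count_space X)"
  shows "compress a \<in> Mnp p n"
proof -
  obtain K where K: "K \<ge> 0" "op_bound p X a K" using bounded_opr_op_bound[OF a] by blast
  have t: "fst (h s) \<in> C" if "s < m" for s
    using h_in[OF that] by (simp add: mem_Times_iff Sigma_def) force
  show ?thesis
  proof (rule bounded_oprI)
    fix f f' s assume ff: "f \<in> lp p {..<n}" "f' \<in> lp p {..<n}"
    show "compress a (f + f') s = compress a f s + compress a f' s"
      using ff t lp_add[OF ff] bounded_opr_add[OF a slice_lp(1) slice_lp(1)]
      by (auto simp: compress_def slice_add)
  next
    fix c f s assume f: "f \<in> lp p {..<n}"
    show "compress a (\<lambda>x. c * f x) s = c * compress a f s"
      using f t lp_scale(1)[OF f] bounded_opr_scale[OF a slice_lp(1)]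
      by (auto simp: compress_def slice_scale)
  next
    show "compress a f s = 0" if "s \<notin> {..<n}" for f s
      using that m_le by (simp add: compress_def)
  qed (auto simp: compress_def fun_eq_iff intro: compress_op_bound K)
qed

end

section \<open>The approximation error\<close>

context exponent
begin

lemma bounded_opr_sum:
  assumes T: "T \<in> bounded_oprs p (count_space X)" and "finite S" "\<And>j. j \<in> S \<Longrightarrow> f j \<in> lp p X"
  shows "T (\<Sum>j\<in>S. f j) = (\<Sum>j\<in>S. T (f j))"
  using assms(2,3)
proof (induction S rule: finite_induct)
  case empty
  show ?case using bounded_opr_scale[OF T lp_zero, of 0] by (simp add: func_zero)
next
  case (insert j S)
  then have "f j \<in> lp p X" "sum f S \<in> lp p X" by (auto intro: lp_sum)
  from bounded_opr_add[OF T this] show ?case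
    using insert by (simp only: sum.insert insert_iff simp_thms)
qed

lemma indicator_lp:
  assumes "z \<in> X"
  shows "(indicator {z} :: _ \<Rightarrow> complex) \<in> lp p X" "lpow p X (indicator {z}) = 1"
  using lp_finite_support[of "{z}" X "indicator {z}" p] assms by auto

lemma bounded_opr_finite_support:
  assumes T: "T \<in> bounded_oprs p (count_space X)" and Z: "finite Z" "Z \<subseteq> X"
    and f: "\<And>x. x \<notin> Z \<Longrightarrow> f x = 0"
  shows "T f y = (\<Sum>z\<in>Z. f z * entry T y z)"
proof -
  have "f = (\<Sum>z\<in>Z. (\<lambda>x. f z * indicator {z} x))"
  proof
    fix x
    have "(\<Sum>z\<in>Z. f z * indicator {z} x) = (\<Sum>z\<in>Z. if z = x then f z else 0)"
      by (intro sum.cong) (auto simp: indicator_def)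
    then show "f x = (\<Sum>z\<in>Z. (\<lambda>x. f z * indicator {z} x)) x"
      using Z f[of x] by (simp add: sum_fun_apply)
  qed
  then have "T f = T (\<Sum>z\<in>Z. (\<lambda>x. f z * indicator {z} x))" by simp
  also have "\<dots> = (\<Sum>z\<in>Z. T (\<lambda>x. f z * indicator {z} x))"
    using Z by (intro bounded_opr_sum[OF T] lp_scale indicator_lp) auto
  also have "\<dots> = (\<Sum>z\<in>Z. (\<lambda>x. f z * T (indicator {z}) x))"
    using Z by (intro sum.cong refl bounded_opr_scale[OF T] indicator_lp) auto
  finally show ?thesis by (simp add: sum_fun_apply entry_def)
qed

text \<open>The row \<open>y\<close> of the matrix determines \<open>f \<mapsto> T f y\<close> because this functional is continuous and
  finitely supported functions are dense in \<open>\<ell>\<^sup>p\<close>.\<close>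
lemma bounded_opr_finite_row:
  assumes T: "T \<in> bounded_oprs p (count_space X)" and Z: "finite Z" "Z \<subseteq> X" and y: "y \<in> X"
    and row: "\<And>z. z \<in> X \<Longrightarrow> z \<notin> Z \<Longrightarrow> entry T y z = 0" and f: "f \<in> lp p X"
  shows "T f y = (\<Sum>z\<in>Z. f z * entry T y z)"
proof -
  obtain K where K: "K \<ge> 0" "op_bound p X T K" using bounded_opr_op_bound[OF T] by blast
  define r where "r = norm (T f y - (\<Sum>z\<in>Z. f z * entry T y z)) powr p"
  have small: "r \<le> K powr p * e" if e: "e > 0" for e
  proof -
    obtain Y where Y: "finite Y" "Y \<subseteq> X"
      and tail: "\<And>V. finite V \<Longrightarrow> V \<subseteq> X - Y \<Longrightarrow> (\<Sum>x\<in>V. norm (f x) powr p) \<le> e"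
      using lp_tail[OF f e] by blast
    \<comment> \<open>\<open>f1\<close> is finitely supported and already yields the claimed sum, as
      the row vanishes on \<open>Y\<close> outside \<open>Z\<close>; \<open>f2\<close> has small
      norm, so \<open>T f2 y\<close> is small.\<close>
    define f1 where "f1 x = (if x \<in> Y \<union> Z then f x else 0)" for x
    define f2 where "f2 x = (if x \<in> Y \<union> Z then 0 else f x)" for x
    have f1: "f1 \<in> lp p X"
      using Y Z by (intro lp_finite_support(1)[of "Y \<union> Z"]) (auto simp: f1_def)
    have f2_le: "(\<Sum>x\<in>V. norm (f2 x) powr p) \<le> e" if V: "finite V" "V \<subseteq> X" for V
    proof -
      have "(\<Sum>x\<in>V. norm (f2 x) powr p) = (\<Sum>x\<in>V - (Y \<union> Z). norm (f x) powr p)"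
        using V by (intro sum.mono_neutral_cong_right) (auto simp: f2_def)
      also have "\<dots> \<le> e" using V by (intro tail) auto
      finally show ?thesis .
    qed
    have f2: "f2 \<in> lp p X"
      using f2_le lp_support[OF f] by (intro lpI[where K = e]) (auto simp: f2_def)
    have "T f1 y = (\<Sum>z\<in>Y \<union> Z. f1 z * entry T y z)"
      using Y Z by (intro bounded_opr_finite_support[OF T]) (auto simp: f1_def)
    also have "\<dots> = (\<Sum>z\<in>Z. f z * entry T y z)"
      using Y Z row by (intro sum.mono_neutral_cong_right) (auto simp: f1_def subset_iff)
    finally have "T f y - (\<Sum>z\<in>Z. f z * entry T y z) = T f y - T f1 y" by simp
    also have "f = f1 + f2" by (auto simp: f1_def f2_def)
    then have "T f y - T f1 y = T f2 y" using bounded_opr_add[OF T f1 f2] by simp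
    finally have "r = norm (T f2 y) powr p" by (simp add: r_def)
    also have "\<dots> \<le> K powr p * lpow p X f2"
      using op_boundD[OF K(2) f2, of "{y}"] y by simp
    also have "\<dots> \<le> K powr p * e"
      by (intro mult_left_mono lpow_le[OF f2] f2_le) auto
    finally show ?thesis .
  qed
  have "r \<le> 0"
  proof (rule field_le_epsilon)
    fix e :: real assume e: "e > 0"
    \<comment> \<open>Dividing by \<open>K powr p + 1\<close> covers \<open>K = 0\<close> and leaves
      a factor of at most 1 before \<open>e\<close>.\<close>
    have "r \<le> K powr p * (e / (K powr p + 1))" using e by (intro small) (simp add: add_nonneg_pos)
    also have "\<dots> = K powr p / (K powr p + 1) * e" by simp
    also have "\<dots> \<le> 1 * e" using e by (intro mult_right_mono) (auto simp: divide_le_eq_1 add_nonneg_pos)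
    finally show "r \<le> 0 + e" by simp
  qed
  then show ?thesis using p_gt_1 by (simp add: r_def)
qed

lemma powr_p_le_iff: "0 \<le> a \<Longrightarrow> 0 \<le> b \<Longrightarrow> a powr p \<le> b powr p \<longleftrightarrow> a \<le> b"
  using p_gt_1 powr_less_mono2[of p b a] powr_mono2[of p a b] by force

lemma entry_le:
  assumes "op_bound p X T K" "K \<ge> 0" "y \<in> X" "z \<in> X"
  shows "norm (entry T y z) \<le> K"
  using op_boundD[OF assms(1) indicator_lp(1)[OF assms(4)], of "{y}"] assms
  by (simp add: indicator_lp entry_def powr_p_le_iff)

text \<open>A crude Schur test. Row \<open>y\<close> involves at most \<open>N\<close> points, which
  costs \<open>real N powr p\<close> by \<open>powr_sum_le\<close>; by symmetry each
  \<open>z\<close> occurs in at most \<open>N\<close> rows, which costs another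
  \<open>real N\<close>. In the applications \<open>\<eta>\<close> is small against these
  factors.\<close>

lemma band_op_bound:
  assumes D: "\<And>f y. f \<in> lp p X \<Longrightarrow> y \<in> X \<Longrightarrow> norm (D f y) \<le> (\<Sum>z\<in>Q y. \<eta> * norm (f z))"
    and Q: "\<And>y. y \<in> X \<Longrightarrow> finite (Q y) \<and> Q y \<subseteq> X \<and> card (Q y) \<le> N"
    and sym: "\<And>y z. y \<in> X \<Longrightarrow> z \<in> X \<Longrightarrow> z \<in> Q y \<longleftrightarrow> y \<in> Q z"
    and \<eta>: "\<eta> \<ge> 0"
  shows "op_bound p X D (\<eta> * real N * real N)"
  unfolding op_bound_def
proof (intro allI impI)
  fix f Y assume f: "f \<in> lp p X" and Y: "finite Y" "Y \<subseteq> X"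
  define H where "H = (\<Union>y\<in>Y. Q y)"
  have H: "finite H" "H \<subseteq> X" unfolding H_def using Q Y by blast+
  have "norm (D f y) powr p \<le> (\<eta> * real N) powr p * (\<Sum>z\<in>Q y. norm (f z) powr p)" if "y \<in> Y" for y
  proof -
    have y: "y \<in> X" using that Y by auto
    have "norm (D f y) \<le> \<eta> * norm (\<Sum>z\<in>Q y. complex_of_real (norm (f z)))"
      using D[OF f y] by (simp add: sum_nonneg sum_distrib_left flip: of_real_sum)
    then have "norm (D f y) powr p \<le> (\<eta> * norm (\<Sum>z\<in>Q y. complex_of_real (norm (f z)))) powr p"
      using p_gt_1 by (intro powr_mono2) auto
    also have "\<dots> = \<eta> powr p * norm (\<Sum>z\<in>Q y. complex_of_real (norm (f z))) powr p"
      using \<eta> by (simp add: powr_mult)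
    also have "\<dots> \<le> \<eta> powr p * (real (card (Q y)) powr p * (\<Sum>z\<in>Q y. norm (f z) powr p))"
      using powr_sum_le[of "Q y" "\<lambda>z. complex_of_real (norm (f z))"] Q[OF y]
      by (intro mult_left_mono) auto
    also have "\<dots> \<le> \<eta> powr p * (real N powr p * (\<Sum>z\<in>Q y. norm (f z) powr p))"
      using Q[OF y] p_gt_1 by (intro mult_left_mono mult_right_mono powr_mono2 sum_nonneg) auto
    finally show ?thesis using \<eta> by (simp add: powr_mult mult.assoc)
  qed
  then have "(\<Sum>y\<in>Y. norm (D f y) powr p)
      \<le> (\<Sum>y\<in>Y. (\<eta> * real N) powr p * (\<Sum>z\<in>Q y. norm (f z) powr p))"
    by (rule sum_mono)
  also have "\<dots> = (\<eta> * real N) powr p * (\<Sum>y\<in>Y. \<Sum>z\<in>{z\<in>H. z \<in> Q y}. norm (f z) powr p)"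
    unfolding sum_distrib_left[symmetric] H_def
    by (intro arg_cong2[where f = "(*)"] sum.cong refl) auto
  also have "(\<Sum>y\<in>Y. \<Sum>z\<in>{z\<in>H. z \<in> Q y}. norm (f z) powr p)
      = (\<Sum>z\<in>H. \<Sum>y\<in>{y\<in>Y. z \<in> Q y}. norm (f z) powr p)"
    by (rule sum.swap_restrict[OF Y(1) H(1)])
  also have "(\<eta> * real N) powr p * \<dots> \<le> (\<eta> * real N) powr p * (real N * lpow p X f)"
  proof (rule mult_left_mono)
    have "(\<Sum>z\<in>H. \<Sum>y\<in>{y\<in>Y. z \<in> Q y}. norm (f z) powr p) \<le> (\<Sum>z\<in>H. real N * norm (f z) powr p)"
    proof (rule sum_mono)
      fix z assume "z \<in> H"
      then have z: "z \<in> X" using H by auto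
      have "card {y\<in>Y. z \<in> Q y} \<le> card (Q z)"
        using Q[OF z] Y sym z by (intro card_mono) auto
      then have "card {y\<in>Y. z \<in> Q y} \<le> N" using Q[OF z] by auto
      then show "(\<Sum>y\<in>{y\<in>Y. z \<in> Q y}. norm (f z) powr p) \<le> real N * norm (f z) powr p"
        by (simp add: mult_right_mono)
    qed
    also have "\<dots> \<le> real N * lpow p X f"
      using sum_le_lpow[OF f H] by (simp add: mult_left_mono flip: sum_distrib_left)
    finally show "(\<Sum>z\<in>H. \<Sum>y\<in>{y\<in>Y. z \<in> Q y}. norm (f z) powr p) \<le> real N * lpow p X f" .
  qed simp
  \<comment> \<open>Rounding \<open>real N\<close> up to \<open>real N powr p\<close> makes the
    whole constant a \<open>p\<close>-th power.\<close>
  also have "\<dots> \<le> (\<eta> * real N) powr p * (real N powr p * lpow p X f)"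
  proof (intro mult_left_mono mult_right_mono lpow_nonneg)
    show "real N \<le> real N powr p"
      using powr_mono[of 1 p "real N"] p_gt_1 by (cases "N = 0") auto
  qed simp
  also have "\<dots> = (\<eta> * real N * real N) powr p * lpow p X f"
    using \<eta> by (simp add: powr_mult)
  finally show "(\<Sum>y\<in>Y. norm (D f y) powr p) \<le> (\<eta> * real N * real N) powr p * lpow p X f" .
qed

end

text \<open>\<open>c x\<close> is the representative whose block replaces that of \<open>x\<close>,
  and \<open>\<pi> x\<close> matches the two balls; by \<open>\<tau>_eq\<close> the ball of
  \<open>x\<close> reads the block of \<open>c x\<close>. The exact normalization
  \<open>w_sum_1\<close> makes the multiplier 1 on the diagonal.\<close>

locale block_approximation = block_synthesis p X B w n \<tau> + block_compression p X B C m n h g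
  for p :: real and X B w n \<tau> C m h g +
  fixes c :: "'a \<Rightarrow> 'a" and \<pi> :: "'a \<Rightarrow> 'a \<Rightarrow> 'a"
  assumes c_in: "x \<in> X \<Longrightarrow> c x \<in> C"
    and \<pi>_bij: "x \<in> X \<Longrightarrow> bij_betw (\<pi> x) (B x) (B (c x))"
    and \<tau>_eq: "x \<in> X \<Longrightarrow> y \<in> B x \<Longrightarrow> \<tau> x y = g (c x, \<pi> x y)"
    and w_sum_1: "y \<in> X \<Longrightarrow> (\<Sum>x\<in>B y. w y x powr p) = 1"
    and w_support: "y \<in> X \<Longrightarrow> x \<notin> B y \<Longrightarrow> w y x = 0"
begin

lemma w_le_1:
  assumes y: "y \<in> X"
  shows "w y x \<le> 1"
proof (cases "x \<in> B y")
  case True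
  then have "w y x powr p \<le> (\<Sum>x\<in>B y. w y x powr p)"
    using finite_B[OF y] by (intro member_le_sum) auto
  then show ?thesis
    using powr_p_le_iff[of "w y x" 1] w_nonneg[OF y] w_sum_1[OF y] by simp
qed (simp add: w_support y)

text \<open>Were \<open>\<pi> x\<close> the identity, this would be Schur multiplication by
  \<open>k(y, z)\<close>. The matching replaces the entry at \<open>(y, z)\<close> by that at the
  corresponding pair in the representative ball.\<close>

lemma synth_compress:
  assumes a: "a \<in> bounded_oprs p (count_space X)" and f: "f \<in> lp p X" and y: "y \<in> X"
  shows "synth (compress a) f y = (\<Sum>x\<in>B y. \<Sum>z\<in>B x.
    complex_of_real (w y x powr (p - 1) * w z x) * f z * entry a (\<pi> x y) (\<pi> x z))"
proof -
  have "compress a (transport x f) (\<tau> x y)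
      = (\<Sum>z\<in>B x. complex_of_real (w z x) * f z * entry a (\<pi> x y) (\<pi> x z))" if "x \<in> B y" for x
  proof -
    have x: "x \<in> X" "y \<in> B x" using that y B_subset B_sym by blast+
    have cx: "c x \<in> C" "c x \<in> X" using c_in x C_subset by auto
    have \<pi>: "\<pi> x z \<in> B (c x)" if "z \<in> B x" for z
      using bij_betwE[OF \<pi>_bij[OF x(1)]] that by blast
    have "compress a (transport x f) (\<tau> x y) = a (slice (c x) (transport x f)) (\<pi> x y)"
      using x cx \<pi> by (simp add: \<tau>_eq compress_g transport_lp)
    also have "\<dots> = (\<Sum>q\<in>B (c x). slice (c x) (transport x f) q * entry a (\<pi> x y) q)"
      using cx by (intro bounded_opr_finite_support[OF a] finite_B B_subset) (auto simp: slice_def)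
    also have "\<dots> = (\<Sum>z\<in>B x. slice (c x) (transport x f) (\<pi> x z) * entry a (\<pi> x y) (\<pi> x z))"
      using sum.reindex_bij_betw[OF \<pi>_bij[OF x(1)],
        of "\<lambda>q. slice (c x) (transport x f) q * entry a (\<pi> x y) q"] by simp
    also have "\<dots> = (\<Sum>z\<in>B x. complex_of_real (w z x) * f z * entry a (\<pi> x y) (\<pi> x z))"
    proof (rule sum.cong[OF refl])
      fix z assume z: "z \<in> B x"
      have "slice (c x) (transport x f) (\<pi> x z) = transport x f (\<tau> x z)"
        using z x \<pi> by (simp add: slice_def \<tau>_eq)
      then show "slice (c x) (transport x f) (\<pi> x z) * entry a (\<pi> x y) (\<pi> x z)
          = complex_of_real (w z x) * f z * entry a (\<pi> x y) (\<pi> x z)"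
        using z x by (simp add: transport_\<tau>)
    qed
    finally show ?thesis .
  qed
  then show ?thesis
    using f y by (simp add: synth_def sum_distrib_left mult.assoc)
qed

text \<open>The kernel is 1 at \<open>z = y\<close>, so its deviation from 1 is the pairing of the
  dual weights of \<open>y\<close> with \<open>w z - w y\<close>, which Hoelder's inequality
  controls.\<close>

lemma kernel_close:
  assumes y: "y \<in> X" and z: "z \<in> X" and \<epsilon>: "\<epsilon> \<ge> 0"
    and w: "(\<Sum>x\<in>B y. \<bar>w z x - w y x\<bar> powr p) \<le> \<epsilon> powr p"
  shows "\<bar>(\<Sum>x\<in>B y. w y x powr (p - 1) * w z x) - 1\<bar> \<le> \<epsilon>"
proof -
  have "w y x powr (p - 1) * w y x = w y x powr p" for x
    using w_nonneg[OF y, of x] powr_mult_base[of "w y x" "p - 1"] by (simp add: mult.commute)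
  then have "(\<Sum>x\<in>B y. w y x powr (p - 1) * w z x) - 1 = (\<Sum>x\<in>B y. w y x powr (p - 1) * (w z x - w y x))"
    using w_sum_1[OF y] by (simp add: right_diff_distrib sum_subtractf)
  then have eq: "\<bar>(\<Sum>x\<in>B y. w y x powr (p - 1) * w z x) - 1\<bar>
      = norm (\<Sum>x\<in>B y. complex_of_real (w y x powr (p - 1)) * complex_of_real (w z x - w y x))"
    by (simp flip: of_real_mult of_real_sum of_real_diff)
  have "norm (\<Sum>x\<in>B y. complex_of_real (w y x powr (p - 1)) * complex_of_real (w z x - w y x)) powr p
      \<le> (\<Sum>x\<in>B y. norm (complex_of_real (w z x - w y x)) powr p)"
    using y by (intro Hoelder_weight finite_B w_nonneg w_sum)
  also have "\<dots> \<le> \<epsilon> powr p"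
    using w by (simp flip: of_real_diff)
  finally show ?thesis unfolding eq using \<epsilon> by (simp add: powr_p_le_iff)
qed

text \<open>\<open>P\<close> is the band of \<open>b\<close>, \<open>Q\<close> the band of the reassembled operators; \<open>\<delta>\<close> may be chosen after \<open>N\<close>, but
  \<open>\<epsilon>\<close>, on which the supports of the weights depend, only has to be small against \<open>N\<^sub>P\<close>.\<close>
lemma synth_compress_error:
  assumes b: "b \<in> bounded_oprs p (count_space X)"
    and P: "\<And>y. y \<in> X \<Longrightarrow> P y \<subseteq> Q y \<and> card (P y) \<le> N\<^sub>P"
    and P_sym: "\<And>y z. y \<in> X \<Longrightarrow> z \<in> X \<Longrightarrow> z \<in> P y \<longleftrightarrow> y \<in> P z"
    and Q: "\<And>y. y \<in> X \<Longrightarrow> finite (Q y) \<and> Q y \<subseteq> X \<and> card (Q y) \<le> N"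
    and Q_sym: "\<And>y z. y \<in> X \<Longrightarrow> z \<in> X \<Longrightarrow> z \<in> Q y \<longleftrightarrow> y \<in> Q z"
    and BQ: "\<And>x y z. y \<in> X \<Longrightarrow> x \<in> B y \<Longrightarrow> z \<in> B x \<Longrightarrow> z \<in> Q y"
    and N: "\<And>y. y \<in> X \<Longrightarrow> card (B y) \<le> N"
    and band: "\<And>y z. y \<in> X \<Longrightarrow> z \<in> X \<Longrightarrow> z \<notin> P y \<Longrightarrow> entry b y z = 0"
    and L: "\<And>y z. y \<in> X \<Longrightarrow> z \<in> X \<Longrightarrow> norm (entry b y z) \<le> L"
    and \<delta>: "\<And>x y z. x \<in> X \<Longrightarrow> y \<in> B x \<Longrightarrow> z \<in> B x \<Longrightarrow>
      norm (entry b (\<pi> x y) (\<pi> x z) - entry b y z) \<le> \<delta>"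
    and w: "\<And>y z. y \<in> X \<Longrightarrow> z \<in> P y \<Longrightarrow> (\<Sum>x\<in>B y. \<bar>w z x - w y x\<bar> powr p) \<le> \<epsilon> powr p"
    and \<epsilon>: "\<epsilon> \<ge> 0" and L0: "L \<ge> 0" and \<delta>0: "\<delta> \<ge> 0"
    and K: "real N * \<delta> * real N * real N \<le> K" "L * \<epsilon> * real N\<^sub>P * real N\<^sub>P \<le> K"
  shows "op_bound p X (synth (compress b) - b) (4 * K)"
proof -
  define k where "k y x z = w y x powr (p - 1) * w z x" for y x z
  \<comment> \<open>\<open>E1\<close> is the error of replacing blocks by representatives,
    \<open>E2\<close> that of having the multiplier \<open>k\<close> instead of 1 on the band of
    \<open>b\<close>.\<close>
  define E1 where "E1 f y = (\<Sum>x\<in>B y. \<Sum>z\<in>B x.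
    complex_of_real (k y x z) * f z * (entry b (\<pi> x y) (\<pi> x z) - entry b y z))" for f y
  define E2 where "E2 f y = (\<Sum>z\<in>P y. f z * entry b y z * complex_of_real ((\<Sum>x\<in>B y. k y x z) - 1))" for f y
  have BX: "x \<in> X" if "x \<in> B y" "y \<in> X" for x y using that B_subset by blast
  have finP: "finite (P y)" "P y \<subseteq> X" if "y \<in> X" for y
    using P[OF that] Q[OF that] finite_subset by blast+
  have k01: "0 \<le> k y x z" "k y x z \<le> 1" if "y \<in> X" "z \<in> X" for y x z
  proof -
    have "w y x powr (p - 1) \<le> 1 powr (p - 1)"
      using that w_le_1 w_nonneg p_gt_1 by (intro powr_mono2) auto
    then show "0 \<le> k y x z" "k y x z \<le> 1"
      using that w_le_1 w_nonneg by (auto simp: k_def intro!: mult_le_one)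
  qed
  have "op_bound p X E1 (real N * \<delta> * real N * real N)"
  proof (rule band_op_bound[where Q = Q])
    fix f y assume f: "f \<in> lp p X" and y: "y \<in> X"
    have "norm (E1 f y) \<le> (\<Sum>x\<in>B y. \<Sum>z\<in>B x. \<delta> * norm (f z))"
      unfolding E1_def
    proof (intro sum_norm_le)
      fix x z assume x: "x \<in> B y" and z: "z \<in> B x"
      have xX: "x \<in> X" and zX: "z \<in> X" and yB: "y \<in> B x"
        using x y z BX B_sym by blast+
      have "norm (complex_of_real (k y x z) * f z * (entry b (\<pi> x y) (\<pi> x z) - entry b y z))
          = k y x z * (norm (f z) * norm (entry b (\<pi> x y) (\<pi> x z) - entry b y z))"
        using k01[OF y zX] by (simp add: norm_mult)
      also have "\<dots> \<le> 1 * (norm (f z) * \<delta>)"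
        using k01[OF y zX] \<delta>[OF xX yB z] by (intro mult_mono) auto
      finally show "norm (complex_of_real (k y x z) * f z * (entry b (\<pi> x y) (\<pi> x z) - entry b y z))
          \<le> \<delta> * norm (f z)" by (simp add: mult.commute)
    qed
    also have "\<dots> \<le> (\<Sum>x\<in>B y. \<Sum>z\<in>Q y. \<delta> * norm (f z))"
      using Q[OF y] BQ[OF y] \<delta>0 by (intro sum_mono sum_mono2) auto
    \<comment> \<open>At most \<open>N\<close> centres \<open>x\<close> contribute, hence the extra
      factor beyond the band estimate for \<open>Q\<close>.\<close>
    also have "\<dots> \<le> real N * (\<Sum>z\<in>Q y. \<delta> * norm (f z))"
      using N[OF y] \<delta>0 by (simp add: mult_right_mono sum_nonneg)
    also have "\<dots> = (\<Sum>z\<in>Q y. real N * \<delta> * norm (f z))"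
      by (simp add: sum_distrib_left mult.assoc)
    finally show "norm (E1 f y) \<le> (\<Sum>z\<in>Q y. real N * \<delta> * norm (f z))" .
  qed (use Q Q_sym \<delta>0 in auto)
  then have E1: "op_bound p X E1 K"
    by (rule op_bound_mono) (use K \<delta>0 in auto)
  have "op_bound p X E2 (L * \<epsilon> * real N\<^sub>P * real N\<^sub>P)"
  proof (rule band_op_bound[where Q = P])
    fix f y assume f: "f \<in> lp p X" and y: "y \<in> X"
    show "norm (E2 f y) \<le> (\<Sum>z\<in>P y. L * \<epsilon> * norm (f z))"
      unfolding E2_def
    proof (rule sum_norm_le)
      fix z assume z: "z \<in> P y"
      then have zX: "z \<in> X" using finP y by blast
      have "norm (f z * entry b y z * complex_of_real ((\<Sum>x\<in>B y. k y x z) - 1))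
          = norm (f z) * (norm (entry b y z) * \<bar>(\<Sum>x\<in>B y. k y x z) - 1\<bar>)"
        by (simp only: norm_mult norm_of_real mult.assoc)
      also have "\<dots> \<le> norm (f z) * (L * \<epsilon>)"
        unfolding k_def using L[OF y zX] kernel_close[OF y zX \<epsilon> w[OF y z]] L0 by (intro mult_left_mono mult_mono) auto
      finally show "norm (f z * entry b y z * complex_of_real ((\<Sum>x\<in>B y. k y x z) - 1)) \<le> L * \<epsilon> * norm (f z)"
        by (simp add: mult.commute)
    qed
  qed (use P finP P_sym L0 \<epsilon> in auto)
  then have E2: "op_bound p X E2 K"
    by (rule op_bound_mono) (use K L0 \<epsilon> in auto)
  have "(synth (compress b) - b) f y = E1 f y + E2 f y" if f: "f \<in> lp p X" and y: "y \<in> X" for f y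
  proof -
    have "synth (compress b) f y - E1 f y
        = (\<Sum>x\<in>B y. \<Sum>z\<in>B x. complex_of_real (k y x z) * f z * entry b y z)"
      using synth_compress[OF b f y] by (simp add: E1_def k_def algebra_simps flip: sum_subtractf)
    \<comment> \<open>Off \<open>P y\<close> the entry of \<open>b\<close> vanishes, and for
      \<open>z\<close> outside \<open>B x\<close> the weight \<open>w z x\<close> does, so both sums
      reduce to \<open>B x \<inter> P y\<close>.\<close>
    also have "\<dots> = (\<Sum>x\<in>B y. \<Sum>z\<in>P y. complex_of_real (k y x z) * f z * entry b y z)"
    proof (rule sum.cong[OF refl])
      fix x assume x: "x \<in> B y"
      have xX: "x \<in> X" using x y BX by blast
      have nz: "complex_of_real (k y x z) * f z * entry b y z = 0" if "z \<in> X" "z \<notin> B x \<or> z \<notin> P y" for z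
        using that w_support[of z x] B_sym[OF xX, of z] band[OF y, of z] by (auto simp: k_def)
      have "(\<Sum>z\<in>B x. complex_of_real (k y x z) * f z * entry b y z)
          = (\<Sum>z\<in>B x \<inter> P y. complex_of_real (k y x z) * f z * entry b y z)"
        using finite_B[OF xX] B_subset[OF xX] nz by (intro sum.mono_neutral_right) auto
      also have "\<dots> = (\<Sum>z\<in>P y. complex_of_real (k y x z) * f z * entry b y z)"
        using finP[OF y] nz by (intro sum.mono_neutral_left) auto
      finally show "(\<Sum>z\<in>B x. complex_of_real (k y x z) * f z * entry b y z)
          = (\<Sum>z\<in>P y. complex_of_real (k y x z) * f z * entry b y z)" .
    qed
    also have "\<dots> = (\<Sum>z\<in>P y. f z * entry b y z * complex_of_real (\<Sum>x\<in>B y. k y x z))"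
      by (subst sum.swap) (simp add: sum_distrib_left mult_ac)
    also have "\<dots> = E2 f y + (\<Sum>z\<in>P y. f z * entry b y z)"
      by (simp add: E2_def algebra_simps flip: sum.distrib)
    \<comment> \<open>Row \<open>y\<close> of \<open>b\<close> is supported in the finite set
      \<open>P y\<close>, so the matrix sum is the true value even for infinitely supported
      \<open>f\<close>.\<close>
    also have "(\<Sum>z\<in>P y. f z * entry b y z) = b f y"
      using bounded_opr_finite_row[OF b finP[OF y] y band[OF y] f] by simp
    finally show ?thesis by (simp add: algebra_simps)
  qed
  then show ?thesis
    using E1 E2 K \<delta>0 by (intro op_bound_add[OF E1 E2]) (auto intro: order_trans[rotated])
qed

end

section \<open>The approximating maps are $p$-complete contractions\<close>

context block_compression
begin

lemma p_complete_contraction_compress: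
  assumes V: "V \<subseteq> bounded_oprs p (count_space X)"
  shows "p_complete_contraction p (count_space X) V (fin_measure n) (Mnp p n) compress"
  unfolding p_complete_contraction_def
proof (intro conjI ballI allI impI)
  fix k :: nat and a assume "\<forall>i<k. \<forall>j<k. a i j \<in> V"
  then have a: "a i j \<in> bounded_oprs p (count_space X)" if "i < k" "j < k" for i j
    using that V by blast
  show "matrix_norm p (fin_measure n) k (\<lambda>i j. compress (a i j)) \<le> matrix_norm p (count_space X) k a"
    by (intro matrix_norm_le compress_bounded_opr a compress_mat_bound mat_bound_matrix_norm)
qed (use V compress_bounded_opr compress_add compress_scale in auto)

end

context block_synthesis
begin

lemma p_complete_contraction_synth:
  assumes W: "\<And>b. b \<in> Mnp p n \<Longrightarrow> synth b \<in> W"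
  shows "p_complete_contraction p (fin_measure n) (Mnp p n) (count_space X) W synth"
  unfolding p_complete_contraction_def
proof (intro conjI ballI allI impI)
  fix k :: nat and b assume "\<forall>i<k. \<forall>j<k. b i j \<in> Mnp p n"
  then have b: "b i j \<in> Mnp p n" if "i < k" "j < k" for i j
    using that by blast
  show "matrix_norm p (count_space X) k (\<lambda>i j. synth (b i j)) \<le> matrix_norm p (fin_measure n) k b"
    by (intro matrix_norm_le synth_bounded_opr b synth_mat_bound mat_bound_matrix_norm)
qed (use W synth_add synth_scale in auto)

text \<open>\<open>transport x\<close> kills the unit vector at \<open>z\<close> unless
  \<open>z\<close> lies in \<open>B x\<close>. A nonzero entry thus needs a ball containing both
  points, which bounds the propagation of \<open>synth b\<close> independently of
  \<open>b\<close>.\<close>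

lemma entry_synth_eq_0:
  assumes b: "b \<in> Mnp p n" and y: "y \<in> X" and z: "z \<in> X" "\<And>x. x \<in> B y \<Longrightarrow> z \<notin> B x"
  shows "entry (synth b) y z = 0"
proof -
  have b0: "b 0 = 0" using bounded_opr_sum[OF b, of "{}"] by simp
  have "transport x (indicator {z}) = 0" if x: "x \<in> B y" for x
  proof
    fix t
    have "x \<in> X" using x y B_subset by blast
    then have "the_inv_into (B x) (\<tau> x) t \<in> B x" if "t \<in> \<tau> x ` B x"
      using the_inv_into_into[OF inj_\<tau>[of x] that subset_refl] by simp
    then have "the_inv_into (B x) (\<tau> x) t \<noteq> z" if "t \<in> \<tau> x ` B x"
      using that z(2)[OF x] by metis
    then show "transport x (indicator {z}) t = 0 t"
      by (auto simp: transport_def)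
  qed
  then show ?thesis
    using b0 by (simp add: entry_def synth_def)
qed

end

section \<open>Operators of finite propagation\<close>

lemma (in exponent) finite_prop_subset_Roe: "finite_prop_oprs p X \<subseteq> uniform_Roe_algebra p X"
proof
  fix T assume T: "T \<in> finite_prop_oprs p X"
  have "op_bound p X (T - T) 0"
    using p_gt_1 by (simp add: op_bound_def)
  moreover have bT: "T \<in> bounded_oprs p (count_space X)"
    using T by (simp add: finite_prop_oprs_def)
  ultimately have "opr_norm p (count_space X) (T - T) \<le> 0"
    by (intro opr_norm_le bounded_opr_diff) auto
  with T bT show "T \<in> uniform_Roe_algebra p X"
    unfolding uniform_Roe_algebra_def by (auto intro!: bexI[of _ T])
qed

lemma finite_propI:
  assumes "T \<in> bounded_oprs p (count_space X)"
    and "\<And>y z. y \<in> X \<Longrightarrow> z \<in> X \<Longrightarrow> entry T y z \<noteq> 0 \<Longrightarrow> dist y z \<le> r"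
  shows "T \<in> finite_prop_oprs p X"
proof -
  have "propagation X T \<le> ennreal r"
    unfolding propagation_def using assms(2) by (intro Sup_least) (auto intro: ennreal_leI)
  then have "propagation X T < \<infinity>"
    using ennreal_less_top[of r] by (metis infinity_ennreal_def order.strict_trans1)
  with assms(1) show ?thesis by (simp add: finite_prop_oprs_def)
qed

lemma finite_propE:
  assumes "T \<in> finite_prop_oprs p X"
  obtains r where "r \<ge> 0" "\<And>y z. y \<in> X \<Longrightarrow> z \<in> X \<Longrightarrow> dist y z > r \<Longrightarrow> entry T y z = 0"
proof -
  define r where "r = enn2real (propagation X T)"
  have fin: "propagation X T < top"
    using assms by (simp add: finite_prop_oprs_def)
  have "entry T y z = 0" if "y \<in> X" "z \<in> X" "dist y z > r" for y z
  proof (rule ccontr)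
    assume "entry T y z \<noteq> 0"
    then have "ennreal (dist y z) \<le> propagation X T"
      unfolding propagation_def using that by (intro Sup_upper) blast
    also have "\<dots> = ennreal r" unfolding r_def using fin by simp
    finally show False using that(3) by (simp add: ennreal_le_iff r_def)
  qed
  then show ?thesis by (rule that[rotated]) (auto simp: r_def)
qed

section \<open>Choosing the weights and the blocks\<close>

lemma floor_eq_imp_close:
  fixes a b d :: real
  assumes "\<lfloor>a / d\<rfloor> = \<lfloor>b / d\<rfloor>" "d > 0"
  shows "\<bar>a - b\<bar> \<le> d"
proof -
  have "\<bar>a / d - b / d\<bar> \<le> 1" using assms(1) by linarith
  also have "\<bar>a / d - b / d\<bar> = \<bar>a - b\<bar> / d"
    using assms(2) by (simp only: diff_divide_distrib[symmetric] abs_divide abs_of_pos)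
  finally show ?thesis using assms(2) by (simp add: divide_le_eq_1)
qed

text \<open>Precompactness of bounded subsets of \<open>\<complex>\<^sup>D\<close>; it cuts the infinite family of blocks down to finitely
  many representatives.\<close>
lemma finite_representatives:
  fixes q :: "'a \<Rightarrow> nat" and v :: "'a \<Rightarrow> 'd \<Rightarrow> complex"
  assumes D: "finite D" and q: "\<And>x. x \<in> X \<Longrightarrow> q x \<le> N"
    and v: "\<And>x d. x \<in> X \<Longrightarrow> d \<in> D \<Longrightarrow> norm (v x d) \<le> L" and \<delta>: "\<delta> > 0"
  obtains C c where "finite C" "C \<subseteq> X" "\<And>x. x \<in> X \<Longrightarrow> c x \<in> C" "\<And>x. x \<in> X \<Longrightarrow> q (c x) = q x"
    "\<And>x d. x \<in> X \<Longrightarrow> d \<in> D \<Longrightarrow> norm (v (c x) d - v x d) \<le> \<delta>"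
proof -
  \<comment> \<open>Mesh \<open>\<delta> / 2\<close> in the real and in the imaginary part adds up
    to \<open>\<delta>\<close> in the modulus.\<close>
  define grid where "grid r = \<lfloor>r / (\<delta> / 2)\<rfloor>" for r :: real
  define sig where "sig x = (q x, restrict (\<lambda>d. (grid (Re (v x d)), grid (Im (v x d)))) D)" for x
  define F where "F s = (SOME x. x \<in> X \<and> sig x = s)" for s
  define c where "c x = F (sig x)" for x
  define I where "I = {grid (- L)..grid L}"
  have grid: "grid r \<in> I" if "\<bar>r\<bar> \<le> L" for r
  proof -
    have "- L / (\<delta> / 2) \<le> r / (\<delta> / 2)" "r / (\<delta> / 2) \<le> L / (\<delta> / 2)"
      using that \<delta> by (intro divide_right_mono; linarith)+
    then show ?thesis
      unfolding I_def grid_def by (intro atLeastAtMost_iff[THEN iffD2] conjI floor_mono)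
  qed
  have "sig ` X \<subseteq> {..N} \<times> (PiE D (\<lambda>_. I \<times> I))"
  proof
    fix s assume "s \<in> sig ` X"
    then obtain x where x: "x \<in> X" "s = sig x" by blast
    have "grid (Re (v x d)) \<in> I \<and> grid (Im (v x d)) \<in> I" if "d \<in> D" for d
      using v[OF x(1) that] abs_Re_le_cmod[of "v x d"] abs_Im_le_cmod[of "v x d"] by (auto intro!: grid)
    then show "s \<in> {..N} \<times> (PiE D (\<lambda>_. I \<times> I))"
      using x q by (auto simp: sig_def)
  qed
  moreover have "finite ({..N} \<times> (PiE D (\<lambda>_. I \<times> I)))"
    using D by (auto intro!: finite_PiE simp: I_def)
  ultimately have "finite (sig ` X)" by (rule finite_subset)
  moreover have "c ` X = F ` (sig ` X)" by (auto simp: c_def)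
  ultimately have fin: "finite (c ` X)" by simp
  have c: "c x \<in> X" "sig (c x) = sig x" if "x \<in> X" for x
    using someI_ex[of "\<lambda>x'. x' \<in> X \<and> sig x' = sig x"] that unfolding c_def F_def by blast+
  have "norm (v (c x) d - v x d) \<le> \<delta>" if "x \<in> X" "d \<in> D" for x d
  proof -
    have "grid (Re (v (c x) d)) = grid (Re (v x d))" "grid (Im (v (c x) d)) = grid (Im (v x d))"
      using c(2)[OF that(1)] that(2) by (auto simp: sig_def restrict_def fun_eq_iff split: if_splits)
    then have "\<bar>Re (v (c x) d) - Re (v x d)\<bar> \<le> \<delta> / 2" "\<bar>Im (v (c x) d) - Im (v x d)\<bar> \<le> \<delta> / 2"
      unfolding grid_def using \<delta> by (intro floor_eq_imp_close; simp)+
    then show ?thesis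
      using cmod_le[of "v (c x) d - v x d"] by simp
  qed
  moreover have "q (c x) = q x" if "x \<in> X" for x
    using c(2)[OF that] by (simp add: sig_def)
  ultimately show ?thesis
    using fin c by (intro that[of "c ` X" c]) auto
qed

lemma finite_uniform_bound:
  assumes "finite F" "\<And>b. b \<in> F \<Longrightarrow> \<exists>r\<ge>0. Q b r"
    and mono: "\<And>b r s. b \<in> F \<Longrightarrow> Q b r \<Longrightarrow> r \<le> s \<Longrightarrow> Q b s"
  obtains r :: real where "r > 0" "\<And>b. b \<in> F \<Longrightarrow> Q b r"
proof -
  obtain \<rho> where \<rho>: "\<And>b. b \<in> F \<Longrightarrow> \<rho> b \<ge> 0 \<and> Q b (\<rho> b)" using assms(2) by metis
  \<comment> \<open>The summand 1 keeps \<open>r\<close> positive even if \<open>F\<close> is empty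
    or all thresholds are 0.\<close>
  define r where "r = 1 + (\<Sum>b\<in>F. \<rho> b)"
  have "Q b r" if "b \<in> F" for b
  proof (rule mono[OF that])
    show "Q b (\<rho> b)" using \<rho> that by blast
    have "\<rho> b \<le> (\<Sum>b\<in>F. \<rho> b)" using \<rho> assms(1) that by (intro member_le_sum) auto
    then show "\<rho> b \<le> r" by (simp add: r_def)
  qed
  moreover have "r > 0" using \<rho> by (simp add: r_def add_pos_nonneg sum_nonneg)
  ultimately show ?thesis by (intro that[of r]) auto
qed

text \<open>Absolute values of the vectors from property A keep norms and supports and, by the
  reverse triangle inequality, do not increase distances.\<close>

lemma (in exponent) property_A_weights:
  fixes X :: "'a::metric_space set"
  assumes A: "property_A X" and R: "R > 0" and \<epsilon>: "\<epsilon> > 0" and fin: "\<And>x r. x \<in> X \<Longrightarrow> finite (cball x r \<inter> X)"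
  obtains S w where "S \<ge> R" "\<And>x y. w y x \<ge> (0::real)" "\<And>x y. y \<in> X \<Longrightarrow> x \<notin> cball y S \<inter> X \<Longrightarrow> w y x = 0"
    "\<And>y. y \<in> X \<Longrightarrow> (\<Sum>x\<in>cball y S \<inter> X. w y x powr p) = 1"
    "\<And>y z. y \<in> X \<Longrightarrow> z \<in> X \<Longrightarrow> dist y z \<le> R \<Longrightarrow>
      (\<Sum>x\<in>cball y S \<inter> X. \<bar>w z x - w y x\<bar> powr p) \<le> \<epsilon> powr p"
proof -
  from p_gt_1 have "1 \<le> p" by simp
  from A[unfolded property_A_def, rule_format, OF this R \<epsilon>] obtain \<xi> :: "'a \<Rightarrow> 'a \<Rightarrow> complex"
    where all: "(\<forall>x\<in>X. \<xi> x \<in> lp p X \<and> lp_norm p X (\<xi> x) = 1) \<and>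
      (\<exists>S>0. \<forall>x\<in>X. \<forall>y\<in>X. \<xi> x y \<noteq> 0 \<longrightarrow> y \<in> cball x S) \<and>
      (\<forall>x\<in>X. \<forall>y\<in>X. dist x y \<le> R \<longrightarrow> lp_norm p X (\<xi> x - \<xi> y) < \<epsilon>)"
    by (rule exE)
  note \<xi> = bspec[OF conjunct1[OF all]]
  have close: "lp_norm p X (\<xi> x - \<xi> y) < \<epsilon>" if "x \<in> X" "y \<in> X" "dist x y \<le> R" for x y
    using conjunct2[OF conjunct2[OF all]] that by blast
  from conjunct1[OF conjunct2[OF all]] obtain S0 where S0: "S0 > 0" "\<And>x y. x \<in> X \<Longrightarrow> y \<in> X \<Longrightarrow> \<xi> x y \<noteq> 0 \<Longrightarrow> y \<in> cball x S0"
    by blast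
  \<comment> \<open>The radius is enlarged to at least \<open>R\<close> so that later the band of
    width \<open>R\<close> lies inside the band of width \<open>2 * S\<close>.\<close>
  define S where "S = max S0 R"
  have zero: "\<xi> y x = 0" if "y \<in> X" "x \<notin> cball y S \<inter> X" for x y
  proof (cases "x \<in> X")
    case True
    with that S0(2)[of y x] show ?thesis by (cases "\<xi> y x = 0") (auto simp: S_def)
  next
    case False
    then show ?thesis using \<xi>[OF that(1)] by (intro lp_support[where p = p and X = X]) simp_all
  qed
  show ?thesis
  proof (rule that[of S "\<lambda>y x. norm (\<xi> y x)"])
    fix y assume y: "y \<in> X"
    have "lpow p X (\<xi> y) = 1"
      using \<xi>[OF y] lp_norm_powr[of X "\<xi> y"] by simp
    then show "(\<Sum>x\<in>cball y S \<inter> X. norm (\<xi> y x) powr p) = 1"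
      using lp_finite_support(2)[OF fin[OF y, of S] _ zero[OF y], where p = p and X = X] by simp
  next
    fix y z assume yz: "y \<in> X" "z \<in> X" "dist y z \<le> R"
    have "\<xi> z + (\<lambda>x. (- 1) * \<xi> y x) \<in> lp p X"
      using \<xi> yz by (intro lp_add lp_scale) auto
    also have "\<xi> z + (\<lambda>x. (- 1) * \<xi> y x) = \<xi> z - \<xi> y"
      by (simp add: fun_eq_iff)
    finally have lp: "\<xi> z - \<xi> y \<in> lp p X" .
    have "(\<Sum>x\<in>cball y S \<inter> X. \<bar>norm (\<xi> z x) - norm (\<xi> y x)\<bar> powr p)
        \<le> (\<Sum>x\<in>cball y S \<inter> X. norm ((\<xi> z - \<xi> y) x) powr p)"
      using p_gt_1 by (intro sum_mono powr_mono2) (auto simp: norm_triangle_ineq3)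
    also have "\<dots> \<le> lpow p X (\<xi> z - \<xi> y)"
      using yz fin by (intro sum_le_lpow[OF lp]) auto
    also have "\<dots> = lp_norm p X (\<xi> z - \<xi> y) powr p"
      by (simp add: lp_norm_powr)
    also have "\<dots> \<le> \<epsilon> powr p"
      using close[of z y] yz p_gt_1 by (intro powr_mono2 lp_norm_nonneg) (auto simp: dist_commute)
    finally show "(\<Sum>x\<in>cball y S \<inter> X. \<bar>norm (\<xi> z x) - norm (\<xi> y x)\<bar> powr p) \<le> \<epsilon> powr p" .
  qed (use zero in \<open>auto simp: S_def\<close>)
qed

text \<open>Once each ball is enumerated, the entries of all \<open>b \<in> F\<close> on it form a
  point of a bounded set in one finite-dimensional space, so finitely many balls represent all up to
  \<open>\<delta>\<close>. The matching sends the i-th point of a ball to the i-th point of its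
  representative.\<close>

lemma matching_blocks:
  fixes B :: "'a \<Rightarrow> 'a set" and F :: "'a opr set"
  assumes F: "finite F" and B: "\<And>x. x \<in> X \<Longrightarrow> finite (B x) \<and> B x \<subseteq> X \<and> card (B x) \<le> N"
    and L: "\<And>b y z. b \<in> F \<Longrightarrow> y \<in> X \<Longrightarrow> z \<in> X \<Longrightarrow> norm (entry b y z) \<le> L" and L0: "L \<ge> 0" and \<delta>: "\<delta> > 0"
  obtains C c \<pi> where "finite C" "C \<subseteq> X" "\<And>x. x \<in> X \<Longrightarrow> c x \<in> C"
    "\<And>x. x \<in> X \<Longrightarrow> bij_betw (\<pi> x) (B x) (B (c x))"
    "\<And>b x y z. b \<in> F \<Longrightarrow> x \<in> X \<Longrightarrow> y \<in> B x \<Longrightarrow> z \<in> B x \<Longrightarrow>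
      norm (entry b (\<pi> x y) (\<pi> x z) - entry b y z) \<le> \<delta>"
proof -
  have "\<exists>e. bij_betw e {..<card (B x)} (B x)" if "x \<in> X" for x
    using ex_bij_betw_nat_finite[of "B x"] B[OF that] by (simp add: atLeast0LessThan)
  then obtain e where e: "\<And>x. x \<in> X \<Longrightarrow> bij_betw (e x) {..<card (B x)} (B x)" by metis
  \<comment> \<open>Smaller balls are padded by zeros to give all entry vectors the same index
    set.\<close>
  define v where "v x = (\<lambda>(b, i, j). if i < card (B x) \<and> j < card (B x) then entry b (e x i) (e x j) else 0)"
    for x
  have v: "norm (v x d) \<le> L" if "x \<in> X" "d \<in> F \<times> {..<N} \<times> {..<N}" for x d
    using that bij_betwE[OF e[OF that(1)]] B[OF that(1)] L L0 by (auto simp: v_def subset_iff)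
  \<comment> \<open>The discrete datum is the cardinality of the ball, so a ball and its
    representative admit a bijection.\<close>
  obtain C c where C: "finite C" "C \<subseteq> X" "\<And>x. x \<in> X \<Longrightarrow> c x \<in> C"
    and card_c: "\<And>x. x \<in> X \<Longrightarrow> card (B (c x)) = card (B x)"
    and close: "\<And>x d. x \<in> X \<Longrightarrow> d \<in> F \<times> {..<N} \<times> {..<N} \<Longrightarrow> norm (v (c x) d - v x d) \<le> \<delta>"
    by (rule finite_representatives[of "F \<times> {..<N} \<times> {..<N}" X "\<lambda>x. card (B x)" N v L \<delta>])
      (use F B v \<delta> in auto)
  define \<pi> where "\<pi> x = e (c x) \<circ> the_inv_into {..<card (B x)} (e x)" for x
  have "bij_betw (\<pi> x) (B x) (B (c x))" if "x \<in> X" for x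
    unfolding \<pi>_def using bij_betw_the_inv_into[OF e[OF that]] e[of "c x"] card_c[OF that] C that
    by (intro bij_betw_trans) auto
  moreover have "norm (entry b (\<pi> x y) (\<pi> x z) - entry b y z) \<le> \<delta>"
    if b: "b \<in> F" and x: "x \<in> X" and yz: "y \<in> B x" "z \<in> B x" for b x y z
  proof -
    obtain i j where ij: "i < card (B x)" "j < card (B x)" "y = e x i" "z = e x j"
      using yz e[OF x] unfolding bij_betw_def by (metis imageE lessThan_iff)
    have "\<pi> x (e x i) = e (c x) i" if "i < card (B x)" for i
      using that e[OF x] by (simp add: \<pi>_def the_inv_into_f_f bij_betw_def)
    then have "entry b (\<pi> x y) (\<pi> x z) - entry b y z = v (c x) (b, i, j) - v x (b, i, j)"
      using ij card_c[OF x] by (simp add: v_def)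
    moreover have "i < N" "j < N" using ij B[OF x] by auto
    ultimately show ?thesis using close[OF x, of "(b, i, j)"] b by simp
  qed
  ultimately show ?thesis using C that by blast
qed

text \<open>The order of choices avoids circularity: approximants of finite propagation fix
  \<open>R\<close> and \<open>L\<close>, hence \<open>N\<^sub>P\<close> and
  \<open>\<epsilon>\<close>; property A then gives \<open>S\<close>, hence \<open>N\<close> and
  \<open>\<delta>\<close>, and the finitely many blocks come last.\<close>

lemma (in exponent) uniform_Roe_algebra_finite_approximation:
  fixes X :: "'a::metric_space set"
  assumes bg: "bounded_geometry X" and A: "property_A X"
    and F: "finite F" "F \<subseteq> uniform_Roe_algebra p X" and e: "e > 0"
  shows "\<exists>n \<phi> \<psi>. n \<ge> 1 \<and>
    p_complete_contraction p (count_space X) (uniform_Roe_algebra p X) (fin_measure n) (Mnp p n) \<phi> \<and>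
    p_complete_contraction p (fin_measure n) (Mnp p n) (count_space X) (uniform_Roe_algebra p X) \<psi> \<and>
    (\<forall>a\<in>F. opr_norm p (count_space X) (\<psi> (\<phi> a) - a) < e)"
proof -
  \<comment> \<open>Two pieces bounded by \<open>4 * \<kappa>\<close> combine to
    \<open>16 * \<kappa> = e / 2\<close>, which leaves room for strict inequality.\<close>
  define \<kappa> where "\<kappa> = e / 32"
  have \<kappa>: "\<kappa> > 0" using e by (simp add: \<kappa>_def)
  have Roe_bounded: "uniform_Roe_algebra p X \<subseteq> bounded_oprs p (count_space X)"
    by (auto simp: uniform_Roe_algebra_def)
  have "\<exists>b\<in>finite_prop_oprs p X. opr_norm p (count_space X) (a - b) < \<kappa>" if "a \<in> F" for a
    using that F(2) \<kappa> by (auto simp: uniform_Roe_algebra_def)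
  then obtain \<beta> where \<beta>: "\<And>a. a \<in> F \<Longrightarrow> \<beta> a \<in> finite_prop_oprs p X \<and> opr_norm p (count_space X) (a - \<beta> a) < \<kappa>"
    by metis
  define F' where "F' = \<beta> ` F"
  have F': "finite F'" "\<And>b. b \<in> F' \<Longrightarrow> b \<in> finite_prop_oprs p X" "\<And>b. b \<in> F' \<Longrightarrow> b \<in> bounded_oprs p (count_space X)"
    using F \<beta> by (auto simp: F'_def finite_prop_oprs_def)
  obtain R where R: "R > 0" "\<And>b. b \<in> F' \<Longrightarrow> \<forall>y\<in>X. \<forall>z\<in>X. dist y z > R \<longrightarrow> entry b y z = 0"
  proof (rule finite_uniform_bound[of F' "\<lambda>b r. \<forall>y\<in>X. \<forall>z\<in>X. dist y z > r \<longrightarrow> entry b y z = 0"])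
    fix b assume "b \<in> F'"
    then obtain r where "r \<ge> 0" "\<And>y z. y \<in> X \<Longrightarrow> z \<in> X \<Longrightarrow> dist y z > r \<Longrightarrow> entry b y z = 0"
      using finite_propE[OF F'(2)] by blast
    then show "\<exists>r\<ge>0. \<forall>y\<in>X. \<forall>z\<in>X. dist y z > r \<longrightarrow> entry b y z = 0" by blast
  qed (use F' in auto)
  obtain L where L: "L > 0" "\<And>b. b \<in> F' \<Longrightarrow> \<forall>y\<in>X. \<forall>z\<in>X. norm (entry b y z) \<le> L"
  proof (rule finite_uniform_bound[of F' "\<lambda>b r. \<forall>y\<in>X. \<forall>z\<in>X. norm (entry b y z) \<le> r"])
    fix b assume "b \<in> F'"
    then obtain K where K: "K \<ge> 0" "op_bound p X b K" using bounded_opr_op_bound[OF F'(3)] by blast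
    show "\<exists>r\<ge>0. \<forall>y\<in>X. \<forall>z\<in>X. norm (entry b y z) \<le> r"
      using K(1) entry_le[OF K(2,1)] by (intro exI[of _ K]) simp
  next
    fix b and r s :: real
    assume "\<forall>y\<in>X. \<forall>z\<in>X. norm (entry b y z) \<le> r" "r \<le> s"
    then show "\<forall>y\<in>X. \<forall>z\<in>X. norm (entry b y z) \<le> s" by (meson order_trans)
  qed (use F' in auto)
  have fin: "finite (cball x r \<inter> X)" if "x \<in> X" for x r
  proof (cases "r \<ge> 0")
    case True
    with bg that show ?thesis unfolding bounded_geometry_def by blast
  qed simp
  obtain N\<^sub>P where NP: "\<And>y. y \<in> X \<Longrightarrow> card (cball y R \<inter> X) \<le> N\<^sub>P"
    using bg R unfolding bounded_geometry_def by (meson less_imp_le)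
  \<comment> \<open>Chosen before \<open>S\<close> is known, so only the band of width
    \<open>R\<close> may enter. The summand 1 avoids division by zero.\<close>
  define \<epsilon> where "\<epsilon> = \<kappa> / (L * real N\<^sub>P * real N\<^sub>P + 1)"
  have \<epsilon>: "\<epsilon> > 0" using \<kappa> L by (simp add: \<epsilon>_def add_nonneg_pos)
  have \<epsilon>\<kappa>: "L * \<epsilon> * real N\<^sub>P * real N\<^sub>P \<le> \<kappa>"
  proof -
    have "L * \<epsilon> * real N\<^sub>P * real N\<^sub>P = (L * real N\<^sub>P * real N\<^sub>P) / (L * real N\<^sub>P * real N\<^sub>P + 1) * \<kappa>"
      by (simp add: \<epsilon>_def)
    also have "\<dots> \<le> 1 * \<kappa>"
      using \<kappa> L by (intro mult_right_mono) (auto simp: divide_le_eq_1 add_nonneg_pos)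
    finally show ?thesis by simp
  qed
  obtain S w where S: "S \<ge> R" and w: "\<And>x y. w y x \<ge> (0::real)"
    "\<And>x y. y \<in> X \<Longrightarrow> x \<notin> cball y S \<inter> X \<Longrightarrow> w y x = 0"
    "\<And>y. y \<in> X \<Longrightarrow> (\<Sum>x\<in>cball y S \<inter> X. w y x powr p) = 1"
    and w_close: "\<And>y z. y \<in> X \<Longrightarrow> z \<in> X \<Longrightarrow> dist y z \<le> R \<Longrightarrow>
      (\<Sum>x\<in>cball y S \<inter> X. \<bar>w z x - w y x\<bar> powr p) \<le> \<epsilon> powr p"
    by (rule property_A_weights[OF A R(1) \<epsilon> fin]) (assumption | rule that)+
  define B where "B x = cball x S \<inter> X" for x
  define P where "P x = cball x R \<inter> X" for x
  \<comment> \<open>Points in a common ball have distance at most \<open>2 * S\<close>, so this band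
    contains all nonzero entries of reassembled operators.\<close>
  define Q where "Q x = cball x (2 * S) \<inter> X" for x
  have S0: "S > 0" using S R by simp
  obtain N where N: "\<And>y. y \<in> X \<Longrightarrow> card (Q y) \<le> N"
    using bg S0 unfolding bounded_geometry_def Q_def by (meson less_imp_le mult_pos_pos zero_less_numeral)
  have BQ: "B y \<subseteq> Q y" for y using S0 by (auto simp: B_def Q_def)
  have finQ: "finite (Q y)" "Q y \<subseteq> X" if "y \<in> X" for y
    using fin[OF that] by (auto simp: Q_def)
  have NB: "card (B y) \<le> N" if "y \<in> X" for y
    using card_mono[OF finQ(1)[OF that] BQ] N[OF that] by simp
  have B: "finite (B x) \<and> B x \<subseteq> X \<and> card (B x) \<le> N" if "x \<in> X" for x
    using fin[OF that] NB[OF that] by (auto simp: B_def)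
  define \<delta> where "\<delta> = \<kappa> / (real N * real N * real N + 1)"
  have \<delta>: "\<delta> > 0" using \<kappa> by (simp add: \<delta>_def add_nonneg_pos)
  have \<delta>\<kappa>: "real N * \<delta> * real N * real N \<le> \<kappa>"
  proof -
    have "real N * \<delta> * real N * real N = (real N * real N * real N) / (real N * real N * real N + 1) * \<kappa>"
      by (simp add: \<delta>_def)
    also have "\<dots> \<le> 1 * \<kappa>"
      using \<kappa> by (intro mult_right_mono) (auto simp: divide_le_eq_1 add_nonneg_pos)
    finally show ?thesis by simp
  qed
  obtain C c \<pi> where C: "finite C" "C \<subseteq> X" "\<And>x. x \<in> X \<Longrightarrow> c x \<in> C"
    and \<pi>: "\<And>x. x \<in> X \<Longrightarrow> bij_betw (\<pi> x) (B x) (B (c x))"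
    and \<pi>_close: "\<And>b x y z. b \<in> F' \<Longrightarrow> x \<in> X \<Longrightarrow> y \<in> B x \<Longrightarrow> z \<in> B x \<Longrightarrow>
      norm (entry b (\<pi> x y) (\<pi> x z) - entry b y z) \<le> \<delta>"
    by (rule matching_blocks[of F' X B N L \<delta>]) (use F'(1) B L \<delta> in auto)
  define m where "m = card (Sigma C B)"
  have "finite (Sigma C B)" using C B by (intro finite_SigmaI) auto
  then obtain h where h: "bij_betw h {..<m} (Sigma C B)"
    using ex_bij_betw_nat_finite[of "Sigma C B"] by (auto simp: m_def atLeast0LessThan)
  define g where "g = the_inv_into {..<m} h"
  define \<tau> where "\<tau> x y = g (c x, \<pi> x y)" for x y
  have g: "bij_betw g (Sigma C B) {..<m}"
    unfolding g_def by (rule bij_betw_the_inv_into[OF h])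
  have c\<pi>: "(c x, \<pi> x y) \<in> Sigma C B" if "x \<in> X" "y \<in> B x" for x y
    using that C bij_betwE[OF \<pi>[OF that(1)]] by auto
  interpret block_approximation p X B w "Suc m" \<tau> C m h g c \<pi>
  proof unfold_locales
    fix x y assume x: "x \<in> X"
    show "inj_on (\<tau> x) (B x)"
    proof (rule inj_onI)
      fix y z assume yz: "y \<in> B x" "z \<in> B x" "\<tau> x y = \<tau> x z"
      then have "\<pi> x y = \<pi> x z"
        using inj_onD[OF bij_betw_imp_inj_on[OF g], of "(c x, \<pi> x y)" "(c x, \<pi> x z)"] c\<pi>[OF x]
        by (simp add: \<tau>_def)
      then show "y = z" using yz \<pi>[OF x] by (meson bij_betw_imp_inj_on inj_onD)
    qed
    show "\<tau> x y < Suc m" if "y \<in> B x"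
      using bij_betwE[OF g] c\<pi>[OF x that] by (auto simp: \<tau>_def intro: less_SucI)
  qed (use B C h w \<pi> in \<open>auto simp: B_def \<tau>_def g_def dist_commute the_inv_into_f_f bij_betw_def\<close>)
  have "synth b \<in> uniform_Roe_algebra p X" if b: "b \<in> Mnp p (Suc m)" for b
  proof -
    have "dist y z \<le> 2 * S" if yz: "y \<in> X" "z \<in> X" "entry (synth b) y z \<noteq> 0" for y z
    proof -
      obtain x where "x \<in> B y" "z \<in> B x"
        using entry_synth_eq_0[OF b yz(1,2)] yz(3) by blast
      then show ?thesis using dist_triangle[of y z x] by (simp add: B_def)
    qed
    then have "synth b \<in> finite_prop_oprs p X"
      by (intro finite_propI[where r = "2 * S"] synth_bounded_opr b)
    then show ?thesis using finite_prop_subset_Roe by blast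
  qed
  note pcc = p_complete_contraction_compress[OF Roe_bounded] p_complete_contraction_synth[OF this]
  have "opr_norm p (count_space X) (synth (compress a) - a) < e" if a: "a \<in> F" for a
  proof -
    define b where "b = \<beta> a"
    have b: "b \<in> F'" and ab: "opr_norm p (count_space X) (a - b) < \<kappa>"
      using a \<beta> by (auto simp: b_def F'_def)
    have bnd: "a \<in> bounded_oprs p (count_space X)" "b \<in> bounded_oprs p (count_space X)"
      using a F(2) Roe_bounded F'(3)[OF b] by auto
    have d: "op_bound p X (a - b) \<kappa>"
      using op_bound_mono[OF op_bound_opr_norm[OF bounded_opr_diff[OF bnd]]]
        opr_norm_nonneg[OF bounded_opr_diff[OF bnd]] ab by simp
    then have d': "op_bound p X (b - a) \<kappa>"
      by (simp add: op_bound_def norm_minus_commute)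
    \<comment> \<open>The error for \<open>a\<close> is
      \<open>synth (compress (a - b)) + (b - a)\<close> plus the error for \<open>b\<close>. Both
      terms of the first part inherit \<open>\<kappa>\<close>, as \<open>compress\<close> and
      \<open>synth\<close> preserve operator bounds.\<close>
    have 1: "op_bound p X (synth (compress (a - b)) + (b - a)) (4 * \<kappa>)"
      using d d' \<kappa> by (intro op_bound_add[OF synth_op_bound[OF compress_op_bound[OF d]] d']) auto
    have 2: "op_bound p X (synth (compress b) - b) (4 * \<kappa>)"
    proof (rule synth_compress_error[OF bnd(2), where P = P and Q = Q and N\<^sub>P = N\<^sub>P and N = N
          and L = L and \<delta> = \<delta> and \<epsilon> = \<epsilon>])
      show "P y \<subseteq> Q y \<and> card (P y) \<le> N\<^sub>P" if "y \<in> X" for y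
        using NP[OF that] S R by (auto simp: P_def Q_def)
      show "z \<in> Q y" if "y \<in> X" "x \<in> B y" "z \<in> B x" for x y z
        using that dist_triangle[of y z x] by (auto simp: B_def Q_def)
      show "(\<Sum>x\<in>B y. \<bar>w z x - w y x\<bar> powr p) \<le> \<epsilon> powr p" if "y \<in> X" "z \<in> P y" for y z
        using that w_close[of y z] by (simp add: B_def P_def)
    qed (use finQ N NB R(2)[OF b] L b \<pi>_close \<epsilon> \<delta> \<epsilon>\<kappa> \<delta>\<kappa> in \<open>auto simp: P_def Q_def dist_commute\<close>)
    have "op_bound p X (synth (compress a) - a) (4 * (4 * \<kappa>))"
      using \<kappa> by (intro op_bound_add[OF 1 2]) (auto simp: compress_diff synth_diff)
    then have "opr_norm p (count_space X) (synth (compress a) - a) \<le> 4 * (4 * \<kappa>)"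
      using \<kappa> by (intro opr_norm_le bounded_opr_diff synth_bounded_opr compress_bounded_opr bnd) auto
    also have "\<dots> < e" using e by (simp add: \<kappa>_def)
    finally show ?thesis .
  qed
  with pcc show ?thesis by (intro exI[of _ "Suc m"] exI[of _ compress] exI[of _ synth]) auto
qed

theorem theorem3p7:
  fixes X :: "'a::metric_space set" and p :: real
  assumes "discrete X"
    and "bounded_geometry X"
    and "property_A X"
    and "1 < p"
  shows "p_nuclear p (count_space X) (uniform_Roe_algebra p X)"
proof -
  interpret exponent p by unfold_locales (rule assms)
  let ?A = "uniform_Roe_algebra p X"
  \<comment> \<open>An index pairs a finite set of operators to be approximated with a number
    \<open>k\<close> encoding the tolerance \<open>1 / (k + 1)\<close>.\<close>
  define I where "I = {\<alpha> :: 'a opr set \<times> nat. finite (fst \<alpha>) \<and> fst \<alpha> \<subseteq> ?A}"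
  define le where "le \<alpha> \<alpha>' \<longleftrightarrow> fst \<alpha> \<subseteq> fst \<alpha>' \<and> snd \<alpha> \<le> snd \<alpha>'" for \<alpha> \<alpha>' :: "'a opr set \<times> nat"
  have "\<forall>\<alpha>\<in>I. \<exists>n \<phi> \<psi>. n \<ge> 1 \<and>
      p_complete_contraction p (count_space X) ?A (fin_measure n) (Mnp p n) \<phi> \<and>
      p_complete_contraction p (fin_measure n) (Mnp p n) (count_space X) ?A \<psi> \<and>
      (\<forall>a\<in>fst \<alpha>. opr_norm p (count_space X) (\<psi> (\<phi> a) - a) < inverse (real (Suc (snd \<alpha>))))"
    using assms by (intro ballI uniform_Roe_algebra_finite_approximation) (auto simp: I_def)
  then obtain n \<phi> \<psi> where approx: "\<And>\<alpha>. \<alpha> \<in> I \<Longrightarrow> n \<alpha> \<ge> 1 \<and>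
      p_complete_contraction p (count_space X) ?A (fin_measure (n \<alpha>)) (Mnp p (n \<alpha>)) (\<phi> \<alpha>) \<and>
      p_complete_contraction p (fin_measure (n \<alpha>)) (Mnp p (n \<alpha>)) (count_space X) ?A (\<psi> \<alpha>) \<and>
      (\<forall>a\<in>fst \<alpha>. opr_norm p (count_space X) (\<psi> \<alpha> (\<phi> \<alpha> a) - a) < inverse (real (Suc (snd \<alpha>))))"
    by metis
  have "directed I le"
    unfolding directed_def
  proof (intro conjI ballI impI)
    show "I \<noteq> {}" by (auto simp: I_def intro!: exI[of _ "{}"])
    fix \<alpha> \<beta> assume "\<alpha> \<in> I" "\<beta> \<in> I"
    then show "\<exists>\<gamma>\<in>I. le \<alpha> \<gamma> \<and> le \<beta> \<gamma>"
      by (intro bexI[of _ "(fst \<alpha> \<union> fst \<beta>, max (snd \<alpha>) (snd \<beta>))"]) (auto simp: I_def le_def)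
  qed (auto simp: le_def)
  moreover have "\<exists>\<alpha>\<^sub>0\<in>I. \<forall>\<alpha>\<in>I. le \<alpha>\<^sub>0 \<alpha> \<longrightarrow> opr_norm p (count_space X) (\<psi> \<alpha> (\<phi> \<alpha> a) - a) < e"
    if a: "a \<in> ?A" and e: "e > 0" for a e
  proof -
    obtain k where k: "inverse (real (Suc k)) < e" using reals_Archimedean[OF e] by blast
    show ?thesis
    \<comment> \<open>Every index beyond \<open>({a}, k)\<close> has \<open>a\<close> in its finite
      set and a tolerance no larger than that of \<open>k\<close>.\<close>
    proof (intro bexI[of _ "({a}, k)"] ballI impI)
      fix \<alpha> assume \<alpha>: "\<alpha> \<in> I" "le ({a}, k) \<alpha>"
      then have "opr_norm p (count_space X) (\<psi> \<alpha> (\<phi> \<alpha> a) - a) < inverse (real (Suc (snd \<alpha>)))"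
        using approx[OF \<alpha>(1)] by (simp add: le_def)
      also have "\<dots> \<le> inverse (real (Suc k))" using \<alpha>(2) by (simp add: le_def)
      finally show "opr_norm p (count_space X) (\<psi> \<alpha> (\<phi> \<alpha> a) - a) < e" using k by simp
    qed (use a in \<open>simp add: I_def\<close>)
  qed
  ultimately have "approximating_net p (count_space X) ?A I le n \<phi> \<psi>"
    unfolding approximating_net_def using approx by blast
  then show ?thesis unfolding p_nuclear_def by blast
qed

end
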